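(* Consider a sequence of bike-sharing networks with finite-capacity stations, indexed by the total number $N$ of nodes, as defined in the context. Assume that: - there exists $C\in\mathbb N$ such that $c_{j,N}\le C$ for all $N$ and all $j\in\mathcal J_1^N$; - there exist $\mu_+,\mu_->0$ such that $\mu_-\le\mu_{a,N}\le\mu_+$ for all $N$ and all $a\in\mathcal J_1^N\cup\mathcal J_2^N$; - there exists $A>0$ such that $\displaystyle\max_{[ij]\in\mathcal J_2^N}\nu_{i,N}q_{ij,N}\le A/J_2^N$ for all $N$; - $\displaystyle\lim_{N\to\infty}M_N=+\infty$ and $\displaystyle\lim_{N\to\infty}(J_2^N)^{-2}M_N=0$. Then, as $N\to\infty$, at stationarity, the queue lengths at stations and routes become asymptotically independent, station $j$ being approximately truncated geometric with parameters $c_{j,N}$ and $\gamma_Nr_{j,N}$, and route $[ij]$ approximately Poisson with parameter $\gamma_Nr_{[ij],N}$. That is, for every $K\ge1$, every choice for each (large) $N$ of $K$ distinct nodes $a_{1,N},\dots,a_{K,N}\in\mathcal J_1^N\cup\mathcal J_2^N$, and every $(n_1,\dots,n_K)\in\mathbb N^K$, $$\lim_{N\to\infty}\frac{\mathbb P(\xi_{a_{1,N},N}=n_1,\dots,\xi_{a_{K,N},N}=n_K)}{\prod_{l=1}^K\mathbb P(\eta_{a_{l,N},N}=n_l)}=1,$$ the ratio being read as $1$ for those $N$ for which $n_l>c_{a_{l,N},N}$ for some $l$ (numerator and denominator then both vanish). Moreover, $\gamma_N$ has the same order of magnitude as $M_N$: there exist constants $0<\alpha\le\beta<\infty$ such that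 $\alpha M_N\le\gamma_N\le\beta M_N$ for all $N$.
   Context: $\mathbb N=\{0,1,2,\dots\}$. For each (sufficiently large) $N$: $\mathcal J_1^N$ is the set of stations, $J_1^N=|\mathcal J_1^N|$; $Q_N=(q_{ij,N})_{i,j\in\mathcal J_1^N}$ is an irreducible stochastic matrix with zero diagonal and invariant probability vector $\nu_N=(\nu_{j,N})$; the set of routes is $\mathcal J_2^N=\{[ij]: i\ne j\in\mathcal J_1^N,\ q_{ij,N}>0\}$, $J_2^N=|\mathcal J_2^N|$; the nodes are the elements of $\mathcal J_1^N\cup\mathcal J_2^N$ and $N=J_1^N+J_2^N$. Station $j$ is a single-server node with service rate $\mu_{j,N}>0$ and finite capacity $c_{j,N}\in\mathbb N$; route $[ij]$ is an infinite-server node with service rate $\mu_{[ij],N}>0$ per customer and capacity $c_{[ij],N}=+\infty$. $M_N$ is the number of bikes (customers). Set $$r_{j,N}=\frac{\nu_{j,N}}{2\mu_{j,N}}\ (j\in\mathcal J_1^N),\qquad r_{[ij],N}=\frac{\nu_{i,N}q_{ij,N}}{2\mu_{[ij],N}}\ ([ij]\in\mathcal J_2^N).$$ The dynamics is any Markovian one (for example, blocking and rerouting) on the state space $$\mathcal S^{c_N}_{N,M_N}=\Big\{(n_a)_{a\in\mathcal J_1^N\cup\mathcal J_2^N}\in\mathbb N^{N}:\sum_a n_a=M_N,\ n_j\le c_{j,N}\ \forall j\in\mathcal J_1^N\Big\}$$ whose stationary distribution, i.e. the law of $(\xi_{a,N})_{a\in\mathcal J_1^N\cup\mathcal J_2^N}$,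 is $$\mathbb P(\xi_{a,N}=n_a\ \forall a)=\frac1{Z_N}\prod_{j\in\mathcal J_1^N}r_{j,N}^{n_j}\prod_{[ij]\in\mathcal J_2^N}\frac{r_{[ij],N}^{n_{[ij]}}}{n_{[ij]}!},\qquad n\in\mathcal S^{c_N}_{N,M_N},$$ with $Z_N$ the normalizing constant. $\gamma_N\in[0,\infty)$ is the unique solution of $$\sum_{j\in\mathcal J_1^N}\frac{\sum_{n=0}^{c_{j,N}}n(\gamma_Nr_{j,N})^n}{\sum_{n=0}^{c_{j,N}}(\gamma_Nr_{j,N})^n}+\sum_{[ij]\in\mathcal J_2^N}\gamma_Nr_{[ij],N}=M_N.$$ For $j\in\mathcal J_1^N$, $\eta_{j,N}$ has the truncated geometric law $\mathbb P(\eta_{j,N}=k)=(\gamma_Nr_{j,N})^k/\sum_{h=0}^{c_{j,N}}(\gamma_Nr_{j,N})^h$, $0\le k\le c_{j,N}$; for $[ij]\in\mathcal J_2^N$, $\eta_{[ij],N}$ is Poisson with parameter $\gamma_Nr_{[ij],N}$. *)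

theory Defs
  imports "HOL-Probability.Probability"
begin

text \<open>The node \<open>Inl j\<close> is the station \<open>j\<close>, the node \<open>Inr (i, j)\<close> is the route \<open>[ij]\<close>.\<close>

type_synonym 'a node = "'a + 'a \<times> 'a"

type_synonym 'a state = "'a node \<Rightarrow> nat"

record 'a bike_network =
  stations :: "'a set"
  routing :: "'a \<Rightarrow> 'a \<Rightarrow> real"
  inv_prob :: "'a \<Rightarrow> real"
  service_rate :: "'a node \<Rightarrow> real"
  station_capacity :: "'a \<Rightarrow> nat"
  bikes :: nat

definition routes :: "'a bike_network \<Rightarrow> ('a \<times> 'a) set" where
  "routes G = {(i, j). i \<in> stations G \<and> j \<in> stations G \<and> i \<noteq> j \<and> routing G i j > 0}"

definition nodes :: "'a bike_network \<Rightarrow> 'a node set" where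
  "nodes G = stations G <+> routes G"

definition stochastic_on :: "'a set \<Rightarrow> ('a \<Rightarrow> 'a \<Rightarrow> real) \<Rightarrow> bool" where
  "stochastic_on J q \<longleftrightarrow> (\<forall>i\<in>J. \<forall>j\<in>J. q i j \<ge> 0) \<and> (\<forall>i\<in>J. (\<Sum>j\<in>J. q i j) = 1)"

definition irreducible_on :: "'a set \<Rightarrow> ('a \<Rightarrow> 'a \<Rightarrow> real) \<Rightarrow> bool" where
  "irreducible_on J q \<longleftrightarrow>
     (\<forall>i\<in>J. \<forall>j\<in>J. (i, j) \<in> {(k, l). k \<in> J \<and> l \<in> J \<and> q k l > 0}\<^sup>*)"

definition invariant_prob_on :: "'a set \<Rightarrow> ('a \<Rightarrow> 'a \<Rightarrow> real) \<Rightarrow> ('a \<Rightarrow> real) \<Rightarrow> bool" where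
  "invariant_prob_on J q \<nu> \<longleftrightarrow>
     (\<forall>j\<in>J. \<nu> j \<ge> 0) \<and> (\<Sum>j\<in>J. \<nu> j) = 1 \<and> (\<forall>j\<in>J. (\<Sum>i\<in>J. \<nu> i * q i j) = \<nu> j)"

definition bike_network :: "'a bike_network \<Rightarrow> bool" where
  "bike_network G \<longleftrightarrow>
     finite (stations G) \<and>
     stochastic_on (stations G) (routing G) \<and>
     irreducible_on (stations G) (routing G) \<and>
     (\<forall>i\<in>stations G. routing G i i = 0) \<and>
     invariant_prob_on (stations G) (routing G) (inv_prob G) \<and>
     (\<forall>a\<in>nodes G. service_rate G a > 0)"

fun capacity :: "'a bike_network \<Rightarrow> 'a node \<Rightarrow> enat" where
  "capacity G (Inl j) = enat (station_capacity G j)"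
| "capacity G (Inr e) = \<infinity>"

fun utilization :: "'a bike_network \<Rightarrow> 'a node \<Rightarrow> real" where
  "utilization G (Inl j) = inv_prob G j / (2 * service_rate G (Inl j))"
| "utilization G (Inr (i, j)) = inv_prob G i * routing G i j / (2 * service_rate G (Inr (i, j)))"

text \<open>A state is a total function, so it is normalized to be \<open>0\<close> outside the nodes.\<close>

definition state_space :: "'a bike_network \<Rightarrow> 'a state set" where
  "state_space G = {n. (\<forall>a. a \<notin> nodes G \<longrightarrow> n a = 0) \<and>
     (\<Sum>a\<in>nodes G. n a) = bikes G \<and>
     (\<forall>j\<in>stations G. n (Inl j) \<le> station_capacity G j)}"

definition product_weight :: "'a bike_network \<Rightarrow> 'a state \<Rightarrow> real" where
  "product_weight G n =
     (\<Prod>j\<in>stations G. utilization G (Inl j) ^ n (Inl j)) *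
     (\<Prod>e\<in>routes G. utilization G (Inr e) ^ n (Inr e) / fact (n (Inr e)))"

definition partition_function :: "'a bike_network \<Rightarrow> real" where
  "partition_function G = (\<Sum>n\<in>state_space G. product_weight G n)"

definition product_form :: "'a bike_network \<Rightarrow> 'a state pmf" where
  "product_form G = embed_pmf (\<lambda>n.
     if n \<in> state_space G then product_weight G n / partition_function G else 0)"

lemma finite_routes:
  assumes "finite (stations G)"
  shows "finite (routes G)"
proof (rule finite_subset)
  show "routes G \<subseteq> stations G \<times> stations G"
    by (auto simp: routes_def)
qed (use assms in simp)

lemma finite_state_space:
  assumes "finite (stations G)"
  shows "finite (state_space G)"
proof -
  have fin: "finite (nodes G)"
    using assms finite_routes[OF assms] by (simp add: nodes_def)
  have "state_space G \<subseteq> {f. \<forall>a. (a \<in> nodes G \<longrightarrow> f a \<in> {..bikes G}) \<and> (a \<notin> nodes G \<longrightarrow> f a = 0)}"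
  proof
    fix n assume n: "n \<in> state_space G"
    have "n a \<le> bikes G" if "a \<in> nodes G" for a
    proof -
      have "n a \<le> (\<Sum>a\<in>nodes G. n a)"
        using that fin by (intro member_le_sum) auto
      thus ?thesis using n by (simp add: state_space_def)
    qed
    thus "n \<in> {f. \<forall>a. (a \<in> nodes G \<longrightarrow> f a \<in> {..bikes G}) \<and> (a \<notin> nodes G \<longrightarrow> f a = 0)}"
      using n by (auto simp: state_space_def)
  qed
  moreover have "finite {f. \<forall>a. (a \<in> nodes G \<longrightarrow> f a \<in> {..bikes G}) \<and> (a \<notin> nodes G \<longrightarrow> f a = 0)}"
    using fin by (intro finite_set_of_finite_funs) auto
  ultimately show ?thesis by (rule finite_subset)
qed

lemma pmf_embed_finite:
  fixes w :: "'s \<Rightarrow> real"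
  assumes "finite S" and nonneg: "\<And>x. x \<in> S \<Longrightarrow> w x \<ge> 0" and pos: "sum w S > 0"
  shows "pmf (embed_pmf (\<lambda>x. if x \<in> S then w x / sum w S else 0)) x =
           (if x \<in> S then w x / sum w S else 0)"
proof (rule pmf_embed_pmf)
  show "0 \<le> (if x \<in> S then w x / sum w S else 0)" for x
    using nonneg pos by simp
  have "(\<integral>\<^sup>+ x. ennreal (if x \<in> S then w x / sum w S else 0) \<partial>count_space UNIV) =
        (\<Sum>x\<in>S. ennreal (if x \<in> S then w x / sum w S else 0))"
    using assms(1) by (intro nn_integral_count_space') auto
  also have "\<dots> = ennreal (\<Sum>x\<in>S. w x / sum w S)"
    using nonneg pos by (subst sum_ennreal[symmetric]) (auto intro!: sum.cong)
  also have "(\<Sum>x\<in>S. w x / sum w S) = 1"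
    using pos by (simp add: sum_divide_distrib[symmetric])
  finally show "(\<integral>\<^sup>+ x. ennreal (if x \<in> S then w x / sum w S else 0) \<partial>count_space UNIV) = 1"
    by simp
qed

lemma bike_network_inv_prob_nonneg:
  "bike_network G \<Longrightarrow> i \<in> stations G \<Longrightarrow> inv_prob G i \<ge> 0"
  by (simp add: bike_network_def invariant_prob_on_def)

lemma utilization_nonneg:
  assumes G: "bike_network G" and a: "a \<in> nodes G"
  shows "utilization G a \<ge> 0"
proof (cases a)
  case (Inl j)
  hence "j \<in> stations G" using a by (auto simp: nodes_def)
  moreover have "service_rate G a > 0" using a G by (auto simp: bike_network_def)
  ultimately show ?thesis using Inl bike_network_inv_prob_nonneg[OF G, of j] by simp
next
  case (Inr e)
  obtain i j where "e = (i, j)" by (cases e)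
  hence "i \<in> stations G" "routing G i j > 0" using a Inr by (auto simp: nodes_def routes_def)
  moreover have "service_rate G a > 0" using a G by (auto simp: bike_network_def)
  ultimately show ?thesis
    using Inr \<open>e = (i, j)\<close> bike_network_inv_prob_nonneg[OF G, of i] by simp
qed

lemma exists_busy_route:
  assumes G: "bike_network G"
  shows "\<exists>e\<in>routes G. utilization G (Inr e) > 0"
proof -
  have "(\<Sum>j\<in>stations G. inv_prob G j) = 1"
    using G by (simp add: bike_network_def invariant_prob_on_def)
  then obtain i where i: "i \<in> stations G" "inv_prob G i \<noteq> 0"
    by (metis sum.neutral zero_neq_one)
  have "(\<Sum>j\<in>stations G. routing G i j) = 1"
    using G i by (simp add: bike_network_def stochastic_on_def)
  then obtain j where j: "j \<in> stations G" "routing G i j \<noteq> 0"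
    by (metis sum.neutral zero_neq_one)
  have ij: "i \<noteq> j" and q: "routing G i j > 0"
    using G i j by (auto simp: bike_network_def stochastic_on_def order_less_le)
  have e: "(i, j) \<in> routes G" using i j ij q by (simp add: routes_def)
  hence "service_rate G (Inr (i, j)) > 0"
    using G by (auto simp: bike_network_def nodes_def)
  moreover have "inv_prob G i > 0"
    using bike_network_inv_prob_nonneg[OF G i(1)] i(2) by simp
  ultimately have "utilization G (Inr (i, j)) > 0" using q by simp
  thus ?thesis using e by blast
qed

lemma pmf_product_form:
  assumes G: "bike_network G"
  shows "pmf (product_form G) n =
    (if n \<in> state_space G then product_weight G n / partition_function G else 0)"
proof -
  have fs: "finite (stations G)" using G by (simp add: bike_network_def)
  note fr = finite_routes[OF fs] and fS = finite_state_space[OF fs]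
  have st: "utilization G (Inl j) \<ge> 0" if "j \<in> stations G" for j
    using that by (intro utilization_nonneg[OF G]) (auto simp: nodes_def)
  have rt: "utilization G (Inr e) \<ge> 0" if "e \<in> routes G" for e
    using that by (intro utilization_nonneg[OF G]) (auto simp: nodes_def)
  have nonneg: "product_weight G n \<ge> 0" for n
    unfolding product_weight_def using st rt
    by (intro mult_nonneg_nonneg prod_nonneg) auto
  obtain e where e: "e \<in> routes G" "utilization G (Inr e) > 0"
    using exists_busy_route[OF G] by blast
  define n0 :: "'a state" where "n0 = (\<lambda>a. if a = Inr e then bikes G else 0)"
  have "(\<Sum>a\<in>nodes G. n0 a) = bikes G"
    using e fs fr by (simp add: n0_def nodes_def InrI)
  hence n0: "n0 \<in> state_space G"
    using e by (auto simp: state_space_def n0_def nodes_def)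
  have "product_weight G n0 > 0"
    unfolding product_weight_def using e
    by (intro mult_pos_pos prod_pos) (auto simp: n0_def)
  hence "sum (product_weight G) (state_space G) > 0"
    using n0 fS nonneg by (intro sum_pos2[of _ n0]) auto
  from pmf_embed_finite[OF fS nonneg this, of n] show ?thesis
    unfolding product_form_def partition_function_def .
qed

text \<open>
  A time-homogeneous Markovian dynamics on \<open>S\<close>: \<open>T t x\<close> is the law at time \<open>t\<close> of the
  process started from \<open>x\<close>.
\<close>

definition markov_semigroup :: "'s set \<Rightarrow> (real \<Rightarrow> 's \<Rightarrow> 's pmf) \<Rightarrow> bool" where
  "markov_semigroup S T \<longleftrightarrow>
     (\<forall>x\<in>S. T 0 x = return_pmf x) \<and>
     (\<forall>t\<ge>0. \<forall>x\<in>S. set_pmf (T t x) \<subseteq> S) \<and>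
     (\<forall>s\<ge>0. \<forall>t\<ge>0. \<forall>x\<in>S. T (s + t) x = bind_pmf (T s x) (T t))"

definition stationary_distribution :: "'s set \<Rightarrow> (real \<Rightarrow> 's \<Rightarrow> 's pmf) \<Rightarrow> 's pmf \<Rightarrow> bool" where
  "stationary_distribution S T p \<longleftrightarrow> set_pmf p \<subseteq> S \<and> (\<forall>t\<ge>0. bind_pmf p (T t) = p)"

definition gamma_eq :: "'a bike_network \<Rightarrow> real \<Rightarrow> bool" where
  "gamma_eq G \<gamma> \<longleftrightarrow>
     (\<Sum>j\<in>stations G.
        (\<Sum>n\<le>station_capacity G j. real n * (\<gamma> * utilization G (Inl j)) ^ n) /
        (\<Sum>n\<le>station_capacity G j. (\<gamma> * utilization G (Inl j)) ^ n)) +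
     (\<Sum>e\<in>routes G. \<gamma> * utilization G (Inr e)) = real (bikes G)"

definition gamma :: "'a bike_network \<Rightarrow> real" where
  "gamma G = (THE \<gamma>. \<gamma> \<ge> 0 \<and> gamma_eq G \<gamma>)"

lemma truncated_geometric_mean_mono:
  fixes x y :: real
  assumes "0 \<le> x" "x \<le> y"
  shows "(\<Sum>n\<le>c. real n * x ^ n) / (\<Sum>n\<le>c. x ^ n) \<le> (\<Sum>n\<le>c. real n * y ^ n) / (\<Sum>n\<le>c. y ^ n)"
proof -
  have pos: "(\<Sum>n\<le>c. z ^ n) > 0" if "z \<ge> 0" for z :: real
    using that by (intro sum_pos2[of _ 0]) auto
  let ?D = "(\<Sum>n\<le>c. \<Sum>m\<le>c. real n * (y ^ n * x ^ m - x ^ n * y ^ m))"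
  have key: "x ^ n * y ^ m \<le> y ^ n * x ^ m" if "m \<le> n" for m n :: nat
  proof -
    have "x ^ (n - m) * (x ^ m * y ^ m) \<le> y ^ (n - m) * (x ^ m * y ^ m)"
      using assms by (intro mult_right_mono power_mono) auto
    moreover have "z ^ (n - m) * z ^ m = z ^ n" for z :: real
      using that by (simp add: power_add[symmetric])
    ultimately show ?thesis
      by (simp add: mult.assoc[symmetric]) (simp add: mult_ac)
  qed
  have summand: "(real n - real m) * (y ^ n * x ^ m - x ^ n * y ^ m) \<ge> 0" for n m
  proof (cases "m \<le> n")
    case True
    thus ?thesis using key[OF True] by simp
  next
    case False
    hence "y ^ n * x ^ m - x ^ n * y ^ m \<le> 0"
      using key[of n m] by (simp add: mult.commute)
    thus ?thesis using False by (intro mult_nonpos_nonpos) auto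
  qed
  have "?D = (\<Sum>n\<le>c. \<Sum>m\<le>c. real m * (y ^ m * x ^ n - x ^ m * y ^ n))"
    by (rule sum.swap)
  hence "2 * ?D = ?D + (\<Sum>n\<le>c. \<Sum>m\<le>c. real m * (y ^ m * x ^ n - x ^ m * y ^ n))"
    by linarith
  also have "\<dots> = (\<Sum>n\<le>c. \<Sum>m\<le>c. (real n - real m) * (y ^ n * x ^ m - x ^ n * y ^ m))"
    unfolding sum.distrib[symmetric] by (intro sum.cong refl) (simp add: algebra_simps)
  also have "\<dots> \<ge> 0" using summand by (intro sum_nonneg)
  finally have "?D \<ge> 0" by simp
  moreover have "?D = (\<Sum>n\<le>c. real n * y ^ n) * (\<Sum>n\<le>c. x ^ n) - (\<Sum>n\<le>c. real n * x ^ n) * (\<Sum>n\<le>c. y ^ n)"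
    by (simp add: sum_product sum_subtractf right_diff_distrib mult.assoc)
  ultimately show ?thesis
    using pos[of x] pos[of y] assms by (simp add: divide_simps)
qed

lemma ex1_gamma_eq:
  assumes G: "bike_network G"
  shows "\<exists>!\<gamma>. \<gamma> \<ge> 0 \<and> gamma_eq G \<gamma>"
proof -
  define F where "F x = (\<Sum>j\<in>stations G.
        (\<Sum>n\<le>station_capacity G j. real n * (x * utilization G (Inl j)) ^ n) /
        (\<Sum>n\<le>station_capacity G j. (x * utilization G (Inl j)) ^ n))" for x
  define R where "R = (\<Sum>e\<in>routes G. utilization G (Inr e))"
  have fs: "finite (stations G)" using G by (simp add: bike_network_def)
  note fr = finite_routes[OF fs]
  have st: "utilization G (Inl j) \<ge> 0" if "j \<in> stations G" for j
    using that by (intro utilization_nonneg[OF G]) (auto simp: nodes_def)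
  have rt: "utilization G (Inr e) \<ge> 0" if "e \<in> routes G" for e
    using that by (intro utilization_nonneg[OF G]) (auto simp: nodes_def)
  have eq: "gamma_eq G x \<longleftrightarrow> F x + x * R = real (bikes G)" for x
    by (simp add: gamma_eq_def F_def R_def sum_distrib_left)
  have R: "R > 0"
  proof -
    obtain e where "e \<in> routes G" "utilization G (Inr e) > 0"
      using exists_busy_route[OF G] by blast
    thus ?thesis unfolding R_def using rt fr by (intro sum_pos2[of _ e]) auto
  qed
  have mono: "F x \<le> F y" if "0 \<le> x" "x \<le> y" for x y
    unfolding F_def using that st
    by (intro sum_mono truncated_geometric_mean_mono mult_right_mono mult_nonneg_nonneg) auto
  have F0: "F 0 = 0"
    unfolding F_def by (intro sum.neutral ballI) (auto simp: power_0_left intro!: sum.neutral)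
  have pos: "(\<Sum>n\<le>station_capacity G j. (x * utilization G (Inl j)) ^ n) \<noteq> 0"
    if "j \<in> stations G" "x \<ge> 0" for j x
  proof -
    have "(\<Sum>n\<le>station_capacity G j. (x * utilization G (Inl j)) ^ n) > 0"
      using that st[of j]
      by (intro sum_pos2[of _ 0] zero_le_power mult_nonneg_nonneg) (auto simp del: utilization.simps)
    thus ?thesis by simp
  qed
  define b where "b = real (bikes G) / R"
  have b: "b \<ge> 0" "b * R = real (bikes G)" using R by (auto simp: b_def)
  have "continuous_on {0..b} (\<lambda>x. F x + x * R)"
    unfolding F_def using pos by (intro continuous_intros) auto
  moreover have "F b \<ge> 0" using mono[of 0 b] F0 b by simp
  ultimately obtain x where x: "0 \<le> x" "F x + x * R = real (bikes G)"
    using IVT'[of "\<lambda>x. F x + x * R" 0 "real (bikes G)" b] F0 b by auto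
  have uniq: False if "0 \<le> y" "y < z" "gamma_eq G y" "gamma_eq G z" for y z
  proof -
    have "y * R < z * R" using that R by simp
    thus False using that mono[of y z] by (simp add: eq)
  qed
  show ?thesis
  proof (rule ex1I[of _ x])
    show "0 \<le> x \<and> gamma_eq G x" using x by (simp add: eq)
  next
    fix y assume "0 \<le> y \<and> gamma_eq G y"
    thus "y = x" using uniq[of x y] uniq[of y x] x by (force simp: eq)
  qed
qed

definition truncated_geometric_pmf :: "nat \<Rightarrow> real \<Rightarrow> nat pmf" where
  "truncated_geometric_pmf c x =
     embed_pmf (\<lambda>k. if k \<le> c then x ^ k / (\<Sum>h\<le>c. x ^ h) else 0)"

lemma pmf_truncated_geometric:
  assumes "x \<ge> 0"
  shows "pmf (truncated_geometric_pmf c x) k = (if k \<le> c then x ^ k / (\<Sum>h\<le>c. x ^ h) else 0)"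
proof -
  have "(\<Sum>h\<le>c. x ^ h) > 0"
    using assms by (intro sum_pos2[of _ 0]) auto
  from pmf_embed_finite[OF _ _ this, of k] assms show ?thesis
    by (simp add: truncated_geometric_pmf_def)
qed

text \<open>\<open>poisson_pmf\<close> is only specified for positive parameters.\<close>

fun node_law :: "'a bike_network \<Rightarrow> 'a node \<Rightarrow> nat pmf" where
  "node_law G (Inl j) =
     truncated_geometric_pmf (station_capacity G j) (gamma G * utilization G (Inl j))"
| "node_law G (Inr e) =
     (let x = gamma G * utilization G (Inr e) in if x > 0 then poisson_pmf x else return_pmf 0)"

end

theory Submission
  imports Defs
begin

text \<open>
  The stationary law is the law of independent nodes \<open>\<eta>\<close> conditioned on their sum \<open>S\<close> being
  \<open>M\<close>. If \<open>S'\<close> is the sum over the nodes that are not chosen and \<open>k\<close> the prescribed content of the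
  chosen ones, the ratio in question is \<open>P(S' = M - k) / P(S = M)\<close>. The routes contribute to \<open>S'\<close>
  one Poisson variable whose parameter \<open>\<rho>\<close> has order \<open>M\<close>. Since the Poisson probabilities
  satisfy \<open>p(m) |m - \<rho>| \<le> 1\<close>, they are Lipschitz with constant \<open>1 / \<rho>\<close>, hence so is the law of
  \<open>S'\<close>, and numerator and denominator differ by at most \<open>(E(S - S') + k) / \<rho>\<close>. The mean
  \<open>E(S - S') = O(1 + M / J2)\<close> is \<open>o(sqrt M)\<close> by assumption, so this difference is
  \<open>o(1 / sqrt M)\<close>, while Chebyshev's inequality for the stations and Stirling's bound for the
  routes give \<open>P(S = M) \<ge> const / sqrt M\<close>.
\<close>

section \<open>Poisson probabilities\<close>

lemma pmf_poisson_Suc: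
  assumes "\<rho> > 0"
  shows "real (Suc m) * pmf (poisson_pmf \<rho>) (Suc m) = \<rho> * pmf (poisson_pmf \<rho>) m"
  using assms by (simp add: field_simps del: of_nat_Suc)

lemma sum_pmf_le_1: "finite J \<Longrightarrow> (\<Sum>j\<in>J. pmf p j) \<le> 1"
  by (metis measure_measure_pmf_finite measure_pmf.prob_le_1)

text \<open>The probabilities increase up to \<rho> and decrease beyond it, so each integer between
  \<open>m\<close> and \<rho> is at least as likely as \<open>m\<close>. There are at least
  \<open>|m - \<rho>|\<close> such integers, and their probabilities add up to at most 1.\<close>

lemma pmf_poisson_deviation:
  assumes l: "\<rho> > 0"
  shows "pmf (poisson_pmf \<rho>) m * \<bar>real m - \<rho>\<bar> \<le> 1"
proof -
  let ?p = "pmf (poisson_pmf \<rho>)"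
  define J where "J = (if \<rho> \<le> real m then {nat \<lceil>\<rho>\<rceil>..m} else {m..nat \<lfloor>\<rho>\<rfloor>})"
  have decr: "?p m \<le> ?p j" if "j \<le> m" "\<rho> \<le> real j" for j
    using that
  proof (induction m rule: dec_induct)
    case (step k)
    have "real (Suc k) * ?p (Suc k) \<le> real (Suc k) * ?p k"
      unfolding pmf_poisson_Suc[OF l] using step by (intro mult_right_mono) auto
    then have "?p (Suc k) \<le> ?p k" by (simp del: of_nat_Suc pmf_poisson)
    then show ?case using step by linarith
  qed simp
  have incr: "?p m \<le> ?p j" if "m \<le> j" "real j \<le> \<rho>" for j
    using that
  proof (induction j rule: dec_induct)
    case (step k)
    have "real (Suc k) * ?p k \<le> real (Suc k) * ?p (Suc k)"
      unfolding pmf_poisson_Suc[OF l] using step by (intro mult_right_mono) auto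
    then have "?p k \<le> ?p (Suc k)" by (simp del: of_nat_Suc pmf_poisson)
    then show ?case using step by simp
  qed simp
  have "?p m \<le> ?p j" if "j \<in> J" for j
  proof (cases "\<rho> \<le> real m")
    case True
    then have "j \<le> m" "\<rho> \<le> real j" using that l by (auto simp: J_def nat_le_iff ceiling_le_iff)
    then show ?thesis by (rule decr)
  next
    case False
    then have "m \<le> j" "j \<le> nat \<lfloor>\<rho>\<rfloor>" using that by (simp_all add: J_def)
    moreover have "real j \<le> \<rho>" using \<open>j \<le> nat \<lfloor>\<rho>\<rfloor>\<close> l by linarith
    ultimately show ?thesis by (blast intro: incr)
  qed
  then have "real (card J) * ?p m \<le> (\<Sum>j\<in>J. ?p j)"
    using sum_mono[of J "\<lambda>_. ?p m" ?p] by simp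
  also have "\<dots> \<le> 1" by (rule sum_pmf_le_1) (simp add: J_def)
  finally have "real (card J) * ?p m \<le> 1" .
  \<comment> \<open>Rounding \<rho> towards \<open>m\<close> loses less than one, and counting both
    endpoints of \<open>J\<close> gains one.\<close>
  moreover have "\<bar>real m - \<rho>\<bar> \<le> real (card J)"
    using l unfolding J_def by (cases "\<rho> \<le> real m") (simp_all, linarith+)
  ultimately show ?thesis
    by (smt (verit, best) mult.commute mult_right_mono pmf_nonneg)
qed

lemma pmf_map_int_nonneg: "pmf (map_pmf int p) (int m) = pmf p m"
  by (rule pmf_map_inj') (simp add: inj_on_def)

lemma pmf_map_int_neg: "z < 0 \<Longrightarrow> pmf (map_pmf int p) z = 0"
  by (rule pmf_map_outside) auto

text \<open>By the Poisson recurrence, \<rho> times the increment from \<open>m\<close> to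
  \<open>m + 1\<close> equals \<open>p (m + 1) * (\<rho> - (m + 1))\<close>, which the deviation
  estimate bounds by 1 in absolute value. The only other jump is from 0 at -1 to
  \<open>p 0\<close>.\<close>

lemma pmf_poisson_step:
  assumes l: "\<rho> > 0"
  defines "P \<equiv> pmf (map_pmf int (poisson_pmf \<rho>))"
  shows "\<bar>P (z + 1) - P z\<bar> \<le> 1 / \<rho>"
proof -
  let ?p = "pmf (poisson_pmf \<rho>)"
  have "z = int (nat z) \<or> z = -1 \<or> z < -1" by linarith
  then consider m where "z = int m" | "z = -1" | "z < -1" by blast
  then show ?thesis
  proof cases
    case (1 m)
    have "int m + 1 = int (Suc m)" by simp
    then have P: "P (z + 1) = ?p (Suc m)" "P z = ?p m"
      unfolding P_def 1 using pmf_map_int_nonneg by metis+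
    have "\<rho> * (?p (Suc m) - ?p m) = - (?p (Suc m) * (real (Suc m) - \<rho>))"
      using pmf_poisson_Suc[OF l, of m] by (simp add: algebra_simps del: of_nat_Suc pmf_poisson)
    then have "\<rho> * \<bar>?p (Suc m) - ?p m\<bar> = ?p (Suc m) * \<bar>real (Suc m) - \<rho>\<bar>"
      using l by (metis abs_minus_cancel abs_mult abs_of_pos abs_of_nonneg pmf_nonneg)
    also have "\<dots> \<le> 1" by (rule pmf_poisson_deviation[OF l])
    finally show ?thesis unfolding P using l by (simp add: field_simps del: pmf_poisson)
  next
    case 2
    have "?p 0 * \<rho> \<le> 1" using pmf_poisson_deviation[OF l, of 0] l by simp
    then show ?thesis
      using l pmf_map_int_nonneg[of "poisson_pmf \<rho>" 0] unfolding P_def 2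
      by (simp add: pmf_map_int_neg field_simps)
  next
    case 3
    then show ?thesis using l by (simp add: P_def pmf_map_int_neg)
  qed
qed

lemma pmf_poisson_lipschitz:
  assumes l: "\<rho> > 0"
  defines "P \<equiv> pmf (map_pmf int (poisson_pmf \<rho>))"
  shows "\<bar>P y - P z\<bar> \<le> \<bar>real_of_int (y - z)\<bar> / \<rho>"
proof -
  have *: "\<bar>P (z + int k) - P z\<bar> \<le> real k / \<rho>" for z k
  proof (induction k)
    case (Suc k)
    have "\<bar>P (z + int (Suc k)) - P (z + int k)\<bar> \<le> 1 / \<rho>"
      using pmf_poisson_step[OF l, of "z + int k"] by (simp add: P_def ac_simps)
    then have "\<bar>P (z + int (Suc k)) - P z\<bar> \<le> 1 / \<rho> + real k / \<rho>" using Suc by linarith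
    then show ?case by (simp add: add_divide_distrib)
  qed simp
  show ?thesis
  proof (cases "z \<le> y")
    case True
    then show ?thesis using *[of z "nat (y - z)"] by simp
  next
    case False
    then show ?thesis using *[of y "nat (z - y)"] by (simp add: abs_minus_commute)
  qed
qed

text \<open>Stirling's formula with the constant \<open>e\<close> in place of
  \<open>sqrt (2 * pi)\<close>, which makes the case \<open>m = 1\<close> an equality. The inductive
  step amounts to \<open>(m + 1/2) * ln (1 + 1/m) \<ge> 1\<close>.\<close>

lemma fact_le_stirling:
  assumes "m \<ge> 1"
  shows "fact m \<le> exp (1 - real m) * real m ^ m * sqrt (real m)"
  using assms
proof (induction m rule: dec_induct)
  case (step m)
  have m: "real m > 0" using step by simp
  \<comment> \<open>The lower bound \<open>2 * (y - x) / (x + y)\<close> for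
    \<open>ln y - ln x\<close> is \<open>1 / (m + 1/2)\<close> at consecutive integers, exactly what
    is needed.\<close>
  have "2 * (real (Suc m) - real m) / (real m + real (Suc m)) \<le> ln (real (Suc m)) - ln (real m)"
    using m by (intro ln_inverse_approx_ge) auto
  then have "1 \<le> (real m + 1/2) * (ln (real (Suc m)) - ln (real m))"
    using m by (simp add: field_simps)
  then have "exp (1 + (real m + 1/2) * ln (real m)) \<le> exp ((real m + 1/2) * ln (real (Suc m)))"
    by (simp add: algebra_simps)
  moreover have "exp ((real m + 1/2) * ln x) = x ^ m * sqrt x" if "x > 0" for x
    using that by (simp add: distrib_right exp_add exp_of_nat_mult ln_sqrt[symmetric])
  ultimately have key: "exp 1 * (real m ^ m * sqrt (real m)) \<le> real (Suc m) ^ m * sqrt (real (Suc m))"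
    using m by (simp add: exp_add del: of_nat_Suc)
  have "fact (Suc m) \<le> real (Suc m) * (exp (1 - real m) * real m ^ m * sqrt (real m))"
    using step by (simp add: mult_left_mono del: of_nat_Suc)
  also have "\<dots> = real (Suc m) * exp (1 - real (Suc m)) * (exp 1 * (real m ^ m * sqrt (real m)))"
    by (simp add: mult_exp_exp del: of_nat_Suc)
  also have "\<dots> \<le> real (Suc m) * exp (1 - real (Suc m)) * (real (Suc m) ^ m * sqrt (real (Suc m)))"
    using key by (intro mult_left_mono) auto
  finally show ?case by (simp add: mult_ac)
qed simp

text \<open>A Gaussian-type bound: after Stirling the logarithm contains
  \<open>m * (ln \<rho> - ln m)\<close>, and \<open>ln t \<le> t - 1\<close> at
  \<open>t = m / \<rho>\<close> bounds this below by \<open>m - m^2 / \<rho>\<close>, which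
  completes the square. Within O(sqrt \<rho>) of the mean the probability is thus at least of order
  \<open>1 / sqrt m\<close>.\<close>

lemma pmf_poisson_ge:
  assumes l: "\<rho> > 0" and m: "m \<ge> 1"
  shows "pmf (poisson_pmf \<rho>) m \<ge> exp (- (real m - \<rho>)\<^sup>2 / \<rho> - 1) / sqrt (real m)"
proof -
  have m0: "real m > 0" using m by simp
  have "ln (real m / \<rho>) \<le> real m / \<rho> - 1" using l m0 by (intro ln_le_minus_one) auto
  then have "real m * (1 - real m / \<rho>) \<le> real m * (ln \<rho> - ln (real m))"
    using l m0 by (intro mult_left_mono) (auto simp: ln_div)
  then have "- (real m - \<rho>)\<^sup>2 / \<rho> - 1 \<le> real m * ln \<rho> - \<rho> - (1 - real m) - real m * ln (real m)"
    using l by (simp add: field_simps power2_eq_square)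
  then have "exp (- (real m - \<rho>)\<^sup>2 / \<rho> - 1)
      \<le> exp (real m * ln \<rho> - \<rho> - (1 - real m) - real m * ln (real m))" by simp
  also have "\<dots> = \<rho> ^ m * exp (- \<rho>) / (exp (1 - real m) * real m ^ m)"
  proof -
    have pw: "x ^ m = exp (real m * ln x)" if "x > 0" for x using that by (simp add: exp_of_nat_mult)
    show ?thesis by (simp add: pw[OF l] pw[OF m0] mult_exp_exp flip: exp_diff)
  qed
  finally have "exp (- (real m - \<rho>)\<^sup>2 / \<rho> - 1) / sqrt (real m)
      \<le> \<rho> ^ m * exp (- \<rho>) / (exp (1 - real m) * real m ^ m * sqrt (real m))"
    using m0 by (simp add: divide_right_mono flip: divide_divide_eq_left)
  also have "\<dots> \<le> \<rho> ^ m * exp (- \<rho>) / fact m"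
    using fact_le_stirling[OF m] l by (intro divide_left_mono mult_pos_pos) (use m0 in auto)
  finally show ?thesis using l by simp
qed

text \<open>The recurrence turns the shifted series of \<open>n * p n\<close> into \<rho> times the
  series of \<open>p\<close>, which sums to 1.\<close>

lemma
  assumes l: "\<rho> > 0"
  shows integrable_poisson: "integrable (poisson_pmf \<rho>) real"
    and expectation_poisson: "measure_pmf.expectation (poisson_pmf \<rho>) real = \<rho>"
proof -
  let ?p = "pmf (poisson_pmf \<rho>)"
  have "(\<lambda>n. \<rho> ^ n / fact n * exp (- \<rho>)) sums (exp \<rho> * exp (- \<rho>))"
    using exp_converges[of \<rho>] by (intro sums_mult2) (simp add: divide_inverse scaleR_conv_of_real mult.commute)
  then have "(\<lambda>n. \<rho> ^ n / fact n * exp (- \<rho>)) sums 1" by (simp only: exp_minus_inverse)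
  moreover have "?p = (\<lambda>n. \<rho> ^ n / fact n * exp (- \<rho>))" using l by (simp add: fun_eq_iff)
  ultimately have "?p sums 1" by simp
  then have "(\<lambda>n. \<rho> * ?p n) sums (\<rho> * 1)" by (rule sums_mult)
  then have "(\<lambda>n. real (Suc n) * ?p (Suc n)) sums \<rho>"
    unfolding pmf_poisson_Suc[OF l] by simp
  then have s: "(\<lambda>n. ?p n * real n) sums \<rho>"
    using sums_Suc_iff[of "\<lambda>n. ?p n * real n" \<rho>] by (simp add: mult.commute del: pmf_poisson)
  then have "summable (\<lambda>n. norm (?p n * real n))" using l by (simp add: sums_iff)
  then have i: "integrable (count_space UNIV) (\<lambda>n. ?p n * real n)"
    by (simp only: integrable_count_space_nat_iff)
  then show "integrable (poisson_pmf \<rho>) real"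
    unfolding measure_pmf_eq_density by (subst integrable_density) (auto simp del: pmf_poisson)
  show "measure_pmf.expectation (poisson_pmf \<rho>) real = \<rho>"
    unfolding measure_pmf_eq_density using sums_integral_count_space_nat[OF i] s
    by (subst integral_density) (auto simp: sums_iff simp del: pmf_poisson)
qed

section \<open>Sums of independent variables\<close>

definition indep_sum :: "'a set \<Rightarrow> ('a \<Rightarrow> nat pmf) \<Rightarrow> nat pmf" where
  "indep_sum F p = map_pmf (\<lambda>x. sum x F) (Pi_pmf F 0 p)"

lemma indep_sum_empty [simp]: "indep_sum {} p = return_pmf 0"
  by (simp add: indep_sum_def)

lemma indep_sum_union:
  assumes "finite A" "finite B" "A \<inter> B = {}"
  shows "indep_sum (A \<union> B) p = map_pmf (\<lambda>(x, y). x + y) (pair_pmf (indep_sum A p) (indep_sum B p))"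
proof -
  have "(\<Sum>a\<in>A \<union> B. if a \<in> A then f a else g a) = sum f A + sum g B" for f g :: "_ \<Rightarrow> nat"
  proof -
    have "(\<Sum>a\<in>B. if a \<in> A then f a else g a) = sum g B"
      using assms(3) by (intro sum.cong) auto
    then show ?thesis using assms by (simp add: sum.union_disjoint)
  qed
  then show ?thesis
    unfolding indep_sum_def Pi_pmf_union[OF assms] map_pair[symmetric]
    by (simp add: map_pmf_comp case_prod_unfold)
qed

lemma indep_sum_singleton [simp]: "indep_sum {a} p = p a"
  by (simp add: indep_sum_def Pi_pmf_singleton map_pmf_comp)

lemma indep_sum_insert:
  assumes "finite A" "a \<notin> A"
  shows "indep_sum (insert a A) p = map_pmf (\<lambda>(x, y). x + y) (pair_pmf (p a) (indep_sum A p))"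
  using indep_sum_union[of "{a}" A p] assms by simp

lemma
  fixes p :: "'a \<Rightarrow> 'b pmf" and f :: "'b \<Rightarrow> real"
  assumes "finite A"
  shows integrable_component_Pi_pmf:
      "a \<in> A \<Longrightarrow> integrable (p a) f \<Longrightarrow> integrable (Pi_pmf A d p) (\<lambda>x. f (x a))"
    and expectation_component_Pi_pmf:
      "a \<in> A \<Longrightarrow> measure_pmf.expectation (Pi_pmf A d p) (\<lambda>x. f (x a)) = measure_pmf.expectation (p a) f"
  using Pi_pmf_component[OF assms, of a d p] integrable_map_pmf_eq[of "\<lambda>x. x a" "Pi_pmf A d p" f]
    integral_map_pmf[of "\<lambda>x. x a" "Pi_pmf A d p" f]
  by (simp_all add: o_def)

lemma
  fixes p :: "'a \<Rightarrow> nat pmf"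
  assumes "finite A" and i: "\<And>a. a \<in> A \<Longrightarrow> integrable (p a) real"
  shows integrable_indep_sum: "integrable (indep_sum A p) real"
    and expectation_indep_sum:
      "measure_pmf.expectation (indep_sum A p) real = (\<Sum>a\<in>A. measure_pmf.expectation (p a) real)"
proof -
  have i': "integrable (Pi_pmf A 0 p) (\<lambda>x. real (x a))" if "a \<in> A" for a
    using integrable_component_Pi_pmf[where f = real and p = p, OF assms(1) that i[OF that]] .
  then show "integrable (indep_sum A p) real"
    unfolding indep_sum_def integrable_map_pmf_eq by (simp add: o_def)
  show "measure_pmf.expectation (indep_sum A p) real = (\<Sum>a\<in>A. measure_pmf.expectation (p a) real)"
    unfolding indep_sum_def integral_map_pmf using i'
    by (simp add: expectation_component_Pi_pmf[OF assms(1)])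
qed

text \<open>Serves to show that sums of bounded variables have finite support, so that every
  function of them is integrable.\<close>

lemma set_indep_sum_le:
  assumes "finite A" "\<And>a. a \<in> A \<Longrightarrow> set_pmf (p a) \<subseteq> {..c}"
  shows "set_pmf (indep_sum A p) \<subseteq> {..card A * c}"
proof
  fix s assume "s \<in> set_pmf (indep_sum A p)"
  then obtain x where x: "x \<in> set_pmf (Pi_pmf A 0 p)" "s = sum x A"
    by (auto simp: indep_sum_def)
  have "x a \<le> c" if "a \<in> A" for a
    using x(1) that assms by (auto simp: set_Pi_pmf PiE_dflt_def)
  then have "sum x A \<le> card A * c" using sum_bounded_above[of A x c] by simp
  then show "s \<in> {..card A * c}" using x by simp
qed

text \<open>Finite supports reduce the expectation to a finite double sum, which factors; this is
  what makes covariances vanish.\<close>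

lemma expectation_pair_pmf_mult:
  fixes f :: "'a \<Rightarrow> real" and g :: "'b \<Rightarrow> real"
  assumes "finite (set_pmf p)" "finite (set_pmf q)"
  shows "measure_pmf.expectation (pair_pmf p q) (\<lambda>(x, y). f x * g y)
    = measure_pmf.expectation p f * measure_pmf.expectation q g"
proof -
  have "measure_pmf.expectation (pair_pmf p q) (\<lambda>(x, y). f x * g y)
    = (\<Sum>z\<in>set_pmf p \<times> set_pmf q. pmf (pair_pmf p q) z *\<^sub>R (case z of (x, y) \<Rightarrow> f x * g y))"
    using assms by (intro integral_measure_pmf) auto
  also have "\<dots> = (\<Sum>x\<in>set_pmf p. \<Sum>y\<in>set_pmf q. (pmf p x * f x) * (pmf q y * g y))"
    unfolding sum.cartesian_product by (intro sum.cong refl) (auto simp: pmf_pair)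
  also have "\<dots> = (\<Sum>x\<in>set_pmf p. pmf p x * f x) * (\<Sum>y\<in>set_pmf q. pmf q y * g y)"
    by (simp add: sum_product)
  finally show ?thesis
    using assms by (simp add: integral_measure_pmf[of "set_pmf p"] integral_measure_pmf[of "set_pmf q"])
qed

text \<open>Variances of independent summands add up, and a variable with values in
  \<open>{0..c}\<close> has variance at most \<open>E(X^2) \<le> c * E(X)\<close>. Bounding by the
  mean is what keeps the standard deviation O(sqrt M) whatever the number of stations.\<close>

lemma second_moment_indep_sum:
  assumes fin: "finite A" and b: "\<And>a. a \<in> A \<Longrightarrow> set_pmf (p a) \<subseteq> {..c}"
  defines "m F \<equiv> \<Sum>a\<in>F. measure_pmf.expectation (p a) real"
  shows "measure_pmf.expectation (indep_sum A p) (\<lambda>x. (real x - m A)\<^sup>2) \<le> real c * m A"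
  using fin b
proof (induction A rule: finite_induct)
  case (insert a A)
  let ?e = "measure_pmf.expectation (p a) real"
  let ?Q = "pair_pmf (p a) (indep_sum A p)"
  have fp: "finite (set_pmf (p a))" and fb: "\<forall>b\<in>A. finite (set_pmf (p b))"
    using insert.prems by (auto intro: finite_subset)
  have fs: "finite (set_pmf (indep_sum A p))"
    using set_indep_sum_le[of A p c] insert by (auto intro: finite_subset)
  have eA: "measure_pmf.expectation (indep_sum A p) (\<lambda>y. real y - m A) = 0"
    using expectation_indep_sum[OF insert.hyps(1), of p] fb
    by (subst Bochner_Integration.integral_diff)
      (auto simp: m_def integrable_measure_pmf_finite fs)
  have ea: "measure_pmf.expectation (p a) (\<lambda>x. (real x - ?e)\<^sup>2) \<le> real c * ?e"
  proof -
    have "measure_pmf.expectation (p a) (\<lambda>x. (real x - ?e)\<^sup>2)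
      = measure_pmf.expectation (p a) (\<lambda>x. (real x)\<^sup>2) - ?e\<^sup>2"
      by (intro measure_pmf.variance_eq integrable_measure_pmf_finite fp)
    also have "\<dots> \<le> measure_pmf.expectation (p a) (\<lambda>x. (real x)\<^sup>2)" by simp
    also have "\<dots> \<le> measure_pmf.expectation (p a) (\<lambda>x. real c * real x)"
    proof (intro integral_mono_AE integrable_measure_pmf_finite fp)
      show "AE x in p a. (real x)\<^sup>2 \<le> real c * real x"
        using insert.prems[of a]
        by (auto simp: AE_measure_pmf_iff power2_eq_square intro!: mult_right_mono)
    qed
    finally show ?thesis by simp
  qed
  have mm: "m (insert a A) = ?e + m A" using insert.hyps by (simp add: m_def)
  have fQ: "finite (set_pmf ?Q)" using fp fs by simp
  note iQ = integrable_measure_pmf_finite[OF fQ]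
  \<comment> \<open>With both parts centred, the square splits into two squares and a cross term
    whose expectation factors and vanishes by \<open>eA\<close>.\<close>
  have "measure_pmf.expectation (indep_sum (insert a A) p) (\<lambda>x. (real x - m (insert a A))\<^sup>2)
    = measure_pmf.expectation ?Q (\<lambda>z. (real (fst z) - ?e)\<^sup>2 + (real (snd z) - m A)\<^sup>2
        + 2 * (case z of (x, y) \<Rightarrow> (real x - ?e) * (real y - m A)))"
    unfolding indep_sum_insert[OF insert.hyps(1,2)] integral_map_pmf mm
    by (intro Bochner_Integration.integral_cong refl) (auto simp: power2_eq_square algebra_simps)
  also have "\<dots> = measure_pmf.expectation (p a) (\<lambda>x. (real x - ?e)\<^sup>2)
      + measure_pmf.expectation (indep_sum A p) (\<lambda>y. (real y - m A)\<^sup>2)"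
    using expectation_pair_pmf_fst[of "p a" "indep_sum A p" "\<lambda>x. (real x - ?e)\<^sup>2"]
      expectation_pair_pmf_snd[of "p a" "indep_sum A p" "\<lambda>y. (real y - m A)\<^sup>2"]
    by (simp add: iQ expectation_pair_pmf_mult[OF fp fs] eA)
  also have "\<dots> \<le> real c * ?e + real c * m A"
    using ea insert by (intro add_mono) auto
  finally show ?case by (simp add: mm distrib_left)
qed (simp add: m_def)

section \<open>Convolutions and Poisson summands\<close>

lemma pmf_add_pair_pmf:
  fixes p q :: "nat pmf"
  shows "pmf (map_pmf (\<lambda>(x, y). x + y) (pair_pmf p q)) n = (\<Sum>i\<le>n. pmf p i * pmf q (n - i))"
proof -
  have "(\<lambda>(x, y). x + y) -` {n} = (\<lambda>i. (i, n - i)) ` {..n}" by force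
  then have "pmf (map_pmf (\<lambda>(x, y). x + y) (pair_pmf p q)) n
    = measure_pmf.prob (pair_pmf p q) ((\<lambda>i. (i, n - i)) ` {..n})" by (simp add: pmf_map)
  also have "\<dots> = (\<Sum>z\<in>(\<lambda>i. (i, n - i)) ` {..n}. pmf (pair_pmf p q) z)"
    by (rule measure_measure_pmf_finite) simp
  also have "\<dots> = (\<Sum>i\<le>n. pmf p i * pmf q (n - i))"
    by (subst sum.reindex) (auto simp: inj_on_def pmf_pair)
  finally show ?thesis .
qed

text \<open>The convolution at \<open>n\<close> is the binomial expansion of
  \<open>(a + b) ^ n\<close>, up to the common factor
  \<open>exp (- (a + b)) / fact n\<close>.\<close>

lemma poisson_add_poisson:
  assumes "a > 0" "b > 0"
  shows "map_pmf (\<lambda>(x, y). x + y) (pair_pmf (poisson_pmf a) (poisson_pmf b)) = poisson_pmf (a + b)"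
proof (rule pmf_eqI)
  fix n
  have "pmf (map_pmf (\<lambda>(x, y). x + y) (pair_pmf (poisson_pmf a) (poisson_pmf b))) n
    = (\<Sum>i\<le>n. (real (n choose i) * a ^ i * b ^ (n - i)) * (exp (- (a + b)) / fact n))"
    unfolding pmf_add_pair_pmf using assms
    by (intro sum.cong refl) (simp add: binomial_fact exp_diff exp_minus field_simps)
  also have "\<dots> = (a + b) ^ n * (exp (- (a + b)) / fact n)"
    unfolding sum_distrib_right[symmetric] by (simp add: binomial_ring)
  also have "\<dots> = pmf (poisson_pmf (a + b)) n" using assms by simp
  finally show "pmf (map_pmf (\<lambda>(x, y). x + y) (pair_pmf (poisson_pmf a) (poisson_pmf b))) n
    = pmf (poisson_pmf (a + b)) n" .
qed

text \<open>\<open>F\<close> is nonempty so that the total parameter is positive, as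
  \<open>poisson_pmf\<close> requires.\<close>

lemma indep_sum_poisson:
  assumes "finite F" "F \<noteq> {}" "\<And>e. e \<in> F \<Longrightarrow> r e > 0" "\<And>e. e \<in> F \<Longrightarrow> p e = poisson_pmf (r e)"
  shows "indep_sum F p = poisson_pmf (sum r F)"
  using assms
proof (induction F rule: finite_ne_induct)
  case (insert x F)
  have "0 < r x" "0 < sum r F" using insert by (auto intro: sum_pos)
  then show ?case using insert by (simp add: indep_sum_insert poisson_add_poisson)
qed simp

text \<open>Passing to \<open>int\<close> keeps the shifted argument \<open>z - y\<close> free of truncated subtraction.\<close>

lemma pmf_int_add_pair_pmf:
  fixes p q :: "nat pmf"
  shows "pmf (map_pmf int (map_pmf (\<lambda>(x, y). x + y) (pair_pmf p q))) z
    = measure_pmf.expectation q (\<lambda>y. pmf (map_pmf int p) (z - int y))"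
proof -
  have "map_pmf int (map_pmf (\<lambda>(x, y). x + y) (pair_pmf p q))
    = bind_pmf q (\<lambda>y. map_pmf (\<lambda>x. x + int y) (map_pmf int p))"
    by (subst pair_commute_pmf) (simp add: pair_pmf_def map_pmf_def bind_assoc_pmf bind_return_pmf)
  moreover have "pmf (map_pmf (\<lambda>x. x + int y) (map_pmf int p)) z = pmf (map_pmf int p) (z - int y)" for y
    using pmf_map_inj'[of "\<lambda>x. x + int y" "map_pmf int p" "z - int y"] by (simp add: inj_on_def)
  ultimately show ?thesis by (simp add: pmf_bind)
qed

lemma integrable_pmf_measure_pmf: "integrable (measure_pmf q) (\<lambda>y. pmf p (f y))"
  by (rule measure_pmf.integrable_const_bound[of _ 1]) (auto simp: pmf_le_1)

text \<open>A Poisson summand makes the law of a sum Lipschitz, so that removing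
  a summand of small mean barely changes point probabilities.\<close>

lemma pmf_add_poisson_diff_le:
  fixes q w :: "nat pmf"
  assumes l: "\<rho> > 0" and i: "integrable q real" and k: "k \<le> M"
  defines "V \<equiv> map_pmf (\<lambda>(x, y). x + y) (pair_pmf (poisson_pmf \<rho>) w)"
  shows "\<bar>pmf (map_pmf (\<lambda>(x, y). x + y) (pair_pmf V q)) M - pmf V (M - k)\<bar>
    \<le> (measure_pmf.expectation q real + real k) / \<rho>"
proof -
  define v where "v = pmf (map_pmf int V)"
  \<comment> \<open>Conditioning on the summand \<open>w\<close> makes \<open>v\<close> a mixture of
    translates of the Poisson probabilities, and averaging preserves the Lipschitz constant
    \<open>1 / \<rho>\<close>.\<close>
  have lip: "\<bar>v y - v z\<bar> \<le> \<bar>real_of_int (y - z)\<bar> / \<rho>" for y z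
  proof -
    let ?P = "pmf (map_pmf int (poisson_pmf \<rho>))"
    have ip: "integrable (measure_pmf w) (\<lambda>d. ?P (u - int d))" for u
      by (rule integrable_pmf_measure_pmf)
    have "v y - v z = measure_pmf.expectation w (\<lambda>d. ?P (y - int d) - ?P (z - int d))"
      unfolding v_def V_def pmf_int_add_pair_pmf
      by (rule Bochner_Integration.integral_diff[symmetric]) (rule ip)+
    also have "\<bar>\<dots>\<bar> \<le> measure_pmf.expectation w (\<lambda>d. \<bar>?P (y - int d) - ?P (z - int d)\<bar>)"
      by (rule integral_abs_bound)
    also have "\<dots> \<le> measure_pmf.expectation w (\<lambda>d. \<bar>real_of_int (y - z)\<bar> / \<rho>)"
    proof (rule integral_mono)
      show "integrable (measure_pmf w) (\<lambda>d. \<bar>?P (y - int d) - ?P (z - int d)\<bar>)"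
        by (intro integrable_abs Bochner_Integration.integrable_diff ip)
      show "\<bar>?P (y - int d) - ?P (z - int d)\<bar> \<le> \<bar>real_of_int (y - z)\<bar> / \<rho>" for d
        using pmf_poisson_lipschitz[OF l, of "y - int d" "z - int d"] by simp
    qed simp
    finally show ?thesis by simp
  qed
  have iv: "integrable (measure_pmf q) (\<lambda>s. v (u - int s))" for u
    unfolding v_def by (rule integrable_pmf_measure_pmf)
  have "pmf (map_pmf (\<lambda>(x, y). x + y) (pair_pmf V q)) M
    = measure_pmf.expectation q (\<lambda>s. v (int M - int s))"
    unfolding v_def by (simp only: pmf_int_add_pair_pmf[symmetric] pmf_map_int_nonneg)
  moreover have "pmf V (M - k) = measure_pmf.expectation q (\<lambda>s. v (int M - int k))"
    \<comment> \<open>A constant is written as an expectation over \<open>q\<close>, so that both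
      probabilities are averages over the same variable and can be compared value by value.\<close>
    using k unfolding v_def by (simp add: pmf_map_int_nonneg flip: of_nat_diff)
  moreover have "measure_pmf.expectation q (\<lambda>s. v (int M - int s) - v (int M - int k))
    = measure_pmf.expectation q (\<lambda>s. v (int M - int s)) - measure_pmf.expectation q (\<lambda>s. v (int M - int k))"
    by (rule Bochner_Integration.integral_diff) (auto intro: iv)
  ultimately have "\<bar>pmf (map_pmf (\<lambda>(x, y). x + y) (pair_pmf V q)) M - pmf V (M - k)\<bar>
    = \<bar>measure_pmf.expectation q (\<lambda>s. v (int M - int s) - v (int M - int k))\<bar>"
    by linarith
  also have "\<dots> \<le> measure_pmf.expectation q (\<lambda>s. \<bar>v (int M - int s) - v (int M - int k)\<bar>)"
    by (rule integral_abs_bound)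
  also have "\<dots> \<le> measure_pmf.expectation q (\<lambda>s. (real s + real k) / \<rho>)"
  proof (rule integral_mono)
    show "integrable (measure_pmf q) (\<lambda>s. \<bar>v (int M - int s) - v (int M - int k)\<bar>)"
      by (intro integrable_abs Bochner_Integration.integrable_diff iv) simp
    show "integrable (measure_pmf q) (\<lambda>s. (real s + real k) / \<rho>)" using i by simp
    show "\<bar>v (int M - int s) - v (int M - int k)\<bar> \<le> (real s + real k) / \<rho>" for s
    proof -
      have "\<bar>real_of_int ((int M - int s) - (int M - int k))\<bar> \<le> real s + real k" by simp
      then show ?thesis
        using lip[of "int M - int s" "int M - int k"] l
        by (meson divide_right_mono less_imp_le order_trans)
    qed
  qed
  also have "\<dots> = (measure_pmf.expectation q real + real k) / \<rho>" using i by simp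
  finally show ?thesis .
qed

text \<open>The bounded part of the sum deviates by \<open>O(sqrt M)\<close> with probability at most \<open>1/2\<close>
  by Chebyshev; otherwise the Poisson part has to hit a point within \<open>O(sqrt M)\<close> of its mean.\<close>

lemma pmf_add_poisson_ge:
  fixes w :: "nat pmf"
  assumes l: "\<rho> > 0" and c: "c > 0" and fw: "finite (set_pmf w)"
    and mean: "\<rho> + measure_pmf.expectation w real = real M"
    and var: "measure_pmf.variance w real \<le> c * real M"
    and big: "1 + sqrt (2 * c * real M) \<le> \<rho>"
  shows "pmf (map_pmf (\<lambda>(x, y). x + y) (pair_pmf (poisson_pmf \<rho>) w)) M
    \<ge> exp (- 2 * c * real M / \<rho> - 1) / (2 * sqrt (real M))"
proof -
  let ?e = "measure_pmf.expectation w real"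
  \<comment> \<open>Chosen so that Chebyshev's bound \<open>c * M / L^2\<close> for leaving the
    window of radius \<open>L\<close> is exactly 1/2.\<close>
  define L where "L = sqrt (2 * c * real M)"
  have e0: "?e \<ge> 0" by simp
  have M: "real M > 0" using mean l e0 by linarith
  have L: "L > 0" "L\<^sup>2 = 2 * c * real M" using c M by (auto simp: L_def)
  define B where "B = {d. \<bar>real d - ?e\<bar> \<ge> L}"
  have "measure_pmf.prob w B \<le> measure_pmf.variance w real / L\<^sup>2"
    using measure_pmf.Chebyshev_inequality[of real w L] L fw
    by (simp add: B_def integrable_measure_pmf_finite)
  also have "\<dots> \<le> c * real M / L\<^sup>2" using var by (intro divide_right_mono) auto
  also have "\<dots> = 1 / 2" using c M by (simp add: L)
  finally have PB: "measure_pmf.prob w (- B) \<ge> 1 / 2"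
    using measure_pmf.prob_compl[of B w] by (simp add: Compl_eq_Diff_UNIV)
  define \<kappa> where "\<kappa> = exp (- 2 * c * real M / \<rho> - 1) / sqrt (real M)"
  let ?P = "pmf (map_pmf int (poisson_pmf \<rho>))"
  have low: "indicator (- B) d * \<kappa> \<le> ?P (int M - int d)" for d
  proof (cases "d \<in> B")
    case False
    then have d: "\<bar>real d - ?e\<bar> < L" by (simp add: B_def)
    \<comment> \<open>On the window, \<open>M - d > \<rho> - L \<ge> 1\<close>, so the Poisson lower
      bound applies at \<open>M - d\<close>. Its distance to \<rho> equals that of \<open>d\<close>
      to the mean of \<open>w\<close>, hence is below \<open>L\<close>.\<close>
    have "real M - real d \<ge> 1" using d mean big by (simp add: L_def)
    then have dM: "d < M" by linarith
    then have m: "M - d \<ge> 1" "real (M - d) = real M - real d" by auto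
    have "(real (M - d) - \<rho>)\<^sup>2 \<le> L\<^sup>2"
      using d mean m(2) L(1) by (intro abs_le_square_iff[THEN iffD1]) auto
    then have "- 2 * c * real M / \<rho> - 1 \<le> - (real (M - d) - \<rho>)\<^sup>2 / \<rho> - 1"
      using l by (simp add: L divide_right_mono)
    then have "\<kappa> \<le> exp (- (real (M - d) - \<rho>)\<^sup>2 / \<rho> - 1) / sqrt (real (M - d))"
      unfolding \<kappa>_def using m by (intro frac_le) auto
    also have "\<dots> \<le> pmf (poisson_pmf \<rho>) (M - d)" by (rule pmf_poisson_ge[OF l m(1)])
    also have "\<dots> = ?P (int M - int d)"
      using dM by (simp only: pmf_map_int_nonneg flip: of_nat_diff)
    finally show ?thesis using False by simp
  qed simp
  have "exp (- 2 * c * real M / \<rho> - 1) / (2 * sqrt (real M)) = 1 / 2 * \<kappa>"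
    by (simp add: \<kappa>_def)
  also have "\<dots> \<le> measure_pmf.prob w (- B) * \<kappa>"
    using PB by (intro mult_right_mono) (auto simp: \<kappa>_def)
  also have "\<dots> = measure_pmf.expectation w (\<lambda>d. indicator (- B) d * \<kappa>)" by simp
  also have "\<dots> \<le> measure_pmf.expectation w (\<lambda>d. ?P (int M - int d))"
    using low by (intro integral_mono integrable_measure_pmf_finite fw)
  also have "\<dots> = pmf (map_pmf (\<lambda>(x, y). x + y) (pair_pmf (poisson_pmf \<rho>) w)) M"
    by (simp only: pmf_int_add_pair_pmf[symmetric] pmf_map_int_nonneg)
  finally show ?thesis .
qed

section \<open>The stationary law as a conditioned product law\<close>

text \<open>Cutting both sets down to the supports makes them countable, as the product formula
  requires.\<close>

lemma prob_pair_pmf_Times: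
  "measure_pmf.prob (pair_pmf p q) (X \<times> Y) = measure_pmf.prob p X * measure_pmf.prob q Y"
proof -
  have "measure_pmf.prob (pair_pmf p q) (X \<times> Y)
    = measure_pmf.prob (pair_pmf p q) ((X \<inter> set_pmf p) \<times> (Y \<inter> set_pmf q))"
    by (intro measure_prob_cong_0) (auto simp: set_pmf_iff pmf_pair)
  also have "\<dots> = measure_pmf.prob p (X \<inter> set_pmf p) * measure_pmf.prob q (Y \<inter> set_pmf q)"
    by (rule measure_pmf_prob_product) auto
  finally show ?thesis by (simp add: measure_Int_set_pmf)
qed

text \<open>The coordinates in \<open>A\<close> and those in \<open>F - A\<close> are independent.
  Once the former are fixed, the total is \<open>M\<close> exactly when the latter sum to
  \<open>M - sum m A\<close>, a subtraction that \<open>k\<close> keeps from being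
  truncated.\<close>

lemma prob_Pi_pmf_coordinates_and_sum:
  fixes p :: "'a \<Rightarrow> nat pmf"
  assumes fin: "finite F" and A: "A \<subseteq> F" and k: "sum m A \<le> M"
  shows "measure_pmf.prob (Pi_pmf F 0 p) {x. (\<forall>a\<in>A. x a = m a) \<and> sum x F = M}
    = (\<Prod>a\<in>A. pmf (p a) (m a)) * pmf (indep_sum (F - A) p) (M - sum m A)"
proof -
  have fA: "finite A" and F: "F = A \<union> (F - A)" using fin A by (auto intro: finite_subset)
  let ?h = "\<lambda>(f, g) x. if x \<in> A then f x else g x"
  let ?X = "{f. \<forall>a\<in>A. f a = m a}" and ?Y = "{g. sum g (F - A) = M - sum m A}"
  have split: "sum (?h (f, g)) F = sum f A + sum g (F - A)" for f g :: "'a \<Rightarrow> nat"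
  proof -
    have "sum (?h (f, g)) F = sum (?h (f, g)) (F - A) + sum (?h (f, g)) A"
      by (rule sum.subset_diff[OF A fin])
    also have "sum (?h (f, g)) (F - A) = sum g (F - A)" by (rule sum.cong) auto
    also have "sum (?h (f, g)) A = sum f A" by (rule sum.cong) auto
    finally show ?thesis by simp
  qed
  \<comment> \<open>In terms of the two independent blocks the event is a rectangle.\<close>
  have vim: "?h -` {x. (\<forall>a\<in>A. x a = m a) \<and> sum x F = M} = ?X \<times> ?Y"
  proof (intro set_eqI)
    fix z :: "('a \<Rightarrow> nat) \<times> ('a \<Rightarrow> nat)"
    obtain f g where z: "z = (f, g)" by (cases z)
    have "sum f A = sum m A" if "\<forall>a\<in>A. f a = m a" using that by (intro sum.cong) auto
    then show "z \<in> ?h -` {x. (\<forall>a\<in>A. x a = m a) \<and> sum x F = M} \<longleftrightarrow> z \<in> ?X \<times> ?Y"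
      using split[of f g] k by (auto simp: z)
  qed
  have "measure_pmf.prob (Pi_pmf F 0 p) {x. (\<forall>a\<in>A. x a = m a) \<and> sum x F = M}
    = measure_pmf.prob (pair_pmf (Pi_pmf A 0 p) (Pi_pmf (F - A) 0 p)) (?X \<times> ?Y)"
    by (subst F, subst Pi_pmf_union) (use fA fin vim F in auto)
  also have "\<dots> = measure_pmf.prob (Pi_pmf A 0 p) ?X * measure_pmf.prob (Pi_pmf (F - A) 0 p) ?Y"
    by (rule prob_pair_pmf_Times)
  also have "measure_pmf.prob (Pi_pmf A 0 p) ?X = (\<Prod>a\<in>A. pmf (p a) (m a))"
    using measure_Pi_pmf_Pi[OF fA, of 0 p "\<lambda>a. {m a}"] by (simp add: Pi_def measure_pmf_single Ball_def)
  also have "measure_pmf.prob (Pi_pmf (F - A) 0 p) ?Y = pmf (indep_sum (F - A) p) (M - sum m A)"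
    by (simp add: indep_sum_def pmf_map vimage_def)
  finally show ?thesis .
qed

section \<open>Positivity of the network parameters and the conditioned node laws\<close>

lemma bike_network_finite:
  assumes "bike_network G"
  shows "finite (stations G)" "finite (routes G)" "finite (nodes G)"
  using assms finite_routes[of G] by (auto simp: bike_network_def nodes_def)

lemma in_nodes_iff [simp]:
  "Inl j \<in> nodes G \<longleftrightarrow> j \<in> stations G" "Inr e \<in> nodes G \<longleftrightarrow> e \<in> routes G"
  by (auto simp: nodes_def)

lemma gamma_nonneg: "bike_network G \<Longrightarrow> gamma G \<ge> 0"
  and gamma_eq_gamma: "bike_network G \<Longrightarrow> gamma_eq G (gamma G)"
  unfolding gamma_def using theI'[OF ex1_gamma_eq] by blast+

text \<open>Some station carries mass, and invariance passes positive mass along every edge of a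
  path to \<open>j\<close>, which irreducibility provides.\<close>

lemma inv_prob_pos:
  assumes G: "bike_network G" and j: "j \<in> stations G"
  shows "inv_prob G j > 0"
proof -
  note nn = bike_network_inv_prob_nonneg[OF G]
  let ?E = "{(k, l). k \<in> stations G \<and> l \<in> stations G \<and> routing G k l > 0}"
  have "(\<Sum>j\<in>stations G. inv_prob G j) = 1"
    using G by (simp add: bike_network_def invariant_prob_on_def)
  then obtain i where i: "i \<in> stations G" "inv_prob G i \<noteq> 0"
    by (metis sum.neutral zero_neq_one)
  have "(i, j) \<in> ?E\<^sup>*" using G i j by (simp add: bike_network_def irreducible_on_def)
  then show ?thesis
  proof (induction rule: rtrancl_induct)
    case base
    then show ?case using nn[OF i(1)] i(2) by simp
  next
    case (step k l)
    have "0 < inv_prob G k * routing G k l" using step by simp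
    also have "\<dots> \<le> (\<Sum>i\<in>stations G. inv_prob G i * routing G i l)"
      using step G nn bike_network_finite(1)[OF G]
      by (intro member_le_sum) (auto simp: bike_network_def stochastic_on_def)
    also have "\<dots> = inv_prob G l"
      using step G by (simp add: bike_network_def invariant_prob_on_def)
    finally show ?case .
  qed
qed

lemma utilization_pos:
  assumes G: "bike_network G" and a: "a \<in> nodes G"
  shows "utilization G a > 0"
proof -
  have "service_rate G a > 0" using a G by (auto simp: bike_network_def)
  then show ?thesis using a inv_prob_pos[OF G] by (auto simp: nodes_def routes_def)
qed

text \<open>At 0 the left-hand side of the equation for \<gamma> vanishes, whereas there is at least
  one bike.\<close>

lemma gamma_pos:
  assumes G: "bike_network G" and M: "bikes G > 0"
  shows "gamma G > 0"
proof (rule ccontr)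
  assume "\<not> gamma G > 0"
  then have "gamma_eq G 0" using gamma_nonneg[OF G] gamma_eq_gamma[OF G] by simp
  \<comment> \<open>The only nonzero power \<open>0 ^ 0\<close> is multiplied by
    \<open>n = 0\<close>.\<close>
  moreover have "(\<Sum>n\<le>c. real n * 0 ^ n) = 0" for c by (intro sum.neutral) (auto simp: power_0_left)
  ultimately show False using M by (simp add: gamma_eq_def)
qed

lemma node_law_route:
  assumes "bike_network G" "bikes G > 0" "e \<in> routes G"
  shows "node_law G (Inr e) = poisson_pmf (gamma G * utilization G (Inr e))"
  using gamma_pos[OF assms(1,2)] utilization_pos[OF assms(1), of "Inr e"] assms(3)
  by (simp add: Let_def del: utilization.simps)

lemma pmf_node_law_station:
  assumes "bike_network G" "j \<in> stations G"
  shows "pmf (node_law G (Inl j)) k = (if k \<le> station_capacity G j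
    then (gamma G * utilization G (Inl j)) ^ k / (\<Sum>h\<le>station_capacity G j. (gamma G * utilization G (Inl j)) ^ h)
    else 0)"
  using gamma_nonneg[OF assms(1)] utilization_nonneg[OF assms(1), of "Inl j"] assms(2)
  by (simp add: pmf_truncated_geometric del: utilization.simps)

lemma set_node_law_station:
  assumes "bike_network G" "j \<in> stations G"
  shows "set_pmf (node_law G (Inl j)) \<subseteq> {..station_capacity G j}"
  using pmf_node_law_station[OF assms] by (auto simp: set_pmf_iff split: if_splits simp del: node_law.simps)

lemma expectation_node_law_station:
  assumes "bike_network G" "j \<in> stations G"
  shows "measure_pmf.expectation (node_law G (Inl j)) real =
    (\<Sum>n\<le>station_capacity G j. real n * (gamma G * utilization G (Inl j)) ^ n) /
    (\<Sum>n\<le>station_capacity G j. (gamma G * utilization G (Inl j)) ^ n)"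
proof -
  have "measure_pmf.expectation (node_law G (Inl j)) real
    = (\<Sum>n\<le>station_capacity G j. pmf (node_law G (Inl j)) n *\<^sub>R real n)"
    using set_node_law_station[OF assms] by (intro integral_measure_pmf) auto
  also have "\<dots> = (\<Sum>n\<le>station_capacity G j. real n * (gamma G * utilization G (Inl j)) ^ n /
    (\<Sum>n\<le>station_capacity G j. (gamma G * utilization G (Inl j)) ^ n))"
    using pmf_node_law_station[OF assms]
    by (intro sum.cong refl) (simp del: node_law.simps utilization.simps)
  finally show ?thesis by (simp add: sum_divide_distrib)
qed

text \<open>Ensures that the product of marginals by which the joint probability is divided is
  nonzero.\<close>

lemma pmf_node_law_pos:
  assumes G: "bike_network G" "bikes G > 0" and a: "a \<in> nodes G" and n: "enat n \<le> capacity G a"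
  shows "pmf (node_law G a) n > 0"
proof -
  have x: "gamma G * utilization G a > 0" using gamma_pos[OF G] utilization_pos[OF G(1) a] by simp
  show ?thesis
  proof (cases a)
    case (Inl j)
    have "0 < (\<Sum>h\<le>station_capacity G j. (gamma G * utilization G (Inl j)) ^ h)"
      using x Inl by (intro sum_pos) (auto simp del: utilization.simps)
    moreover have "j \<in> stations G" using a Inl by (auto simp: nodes_def)
    ultimately show ?thesis
      using x n Inl by (simp add: pmf_node_law_station[OF G(1)] del: utilization.simps node_law.simps)
  next
    case (Inr e)
    then have "e \<in> routes G" using a by (auto simp: nodes_def)
    then show ?thesis using x Inr by (simp add: node_law_route[OF G] del: utilization.simps node_law.simps)
  qed
qed

text \<open>The factors \<open>\<gamma> ^ n\<close> multiply to \<open>\<gamma> ^ M\<close> on the state space, so tilting by \<open>\<gamma>\<close> does not change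
  the conditional law given the total.\<close>

lemma pmf_Pi_node_law:
  assumes G: "bike_network G" "bikes G > 0"
  shows "\<exists>\<kappa>>0. \<forall>n\<in>state_space G. pmf (Pi_pmf (nodes G) 0 (node_law G)) n = \<kappa> * product_weight G n"
proof -
  let ?g = "gamma G"
  define D where "D j = (\<Sum>h\<le>station_capacity G j. (?g * utilization G (Inl j)) ^ h)" for j
  \<comment> \<open>Collects everything that does not depend on the state: the power of \<gamma>,
    the geometric normalizations and the Poisson exponentials.\<close>
  define \<kappa> where "\<kappa> = ?g ^ bikes G * ((\<Prod>j\<in>stations G. 1 / D j) * (\<Prod>e\<in>routes G. exp (- ?g * utilization G (Inr e))))"
  have g: "?g > 0" by (rule gamma_pos[OF G])
  note fin = bike_network_finite[OF G(1)]
  have "D j > 0" if "j \<in> stations G" for j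
    unfolding D_def using g utilization_pos[OF G(1), of "Inl j"] that
    by (intro sum_pos) (auto simp del: utilization.simps)
  then have "\<kappa> > 0" unfolding \<kappa>_def using g by (intro mult_pos_pos prod_pos) auto
  moreover have "pmf (Pi_pmf (nodes G) 0 (node_law G)) n = \<kappa> * product_weight G n"
    if n: "n \<in> state_space G" for n
  proof -
    have "bikes G = sum n (stations G <+> routes G)"
      using n by (simp add: state_space_def nodes_def)
    also have "\<dots> = (\<Sum>j\<in>stations G. n (Inl j)) + (\<Sum>e\<in>routes G. n (Inr e))"
      using fin by (simp add: sum.Plus)
    finally have gM: "?g ^ bikes G = (\<Prod>j\<in>stations G. ?g ^ n (Inl j)) * (\<Prod>e\<in>routes G. ?g ^ n (Inr e))"
      by (simp add: power_add power_sum)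
    have st: "pmf (node_law G (Inl j)) (n (Inl j))
      = ?g ^ n (Inl j) * (1 / D j) * utilization G (Inl j) ^ n (Inl j)" if "j \<in> stations G" for j
      using n that
      by (simp add: pmf_node_law_station[OF G(1) that] state_space_def D_def power_mult_distrib
          del: node_law.simps utilization.simps)
    have rt: "pmf (node_law G (Inr e)) (n (Inr e))
      = ?g ^ n (Inr e) * exp (- ?g * utilization G (Inr e)) * (utilization G (Inr e) ^ n (Inr e) / fact (n (Inr e)))"
      if "e \<in> routes G" for e
      using g utilization_pos[OF G(1), of "Inr e"] that
      by (simp add: node_law_route[OF G that] power_mult_distrib
          del: node_law.simps utilization.simps)
    \<comment> \<open>A state vanishes off the nodes, in agreement with the default value 0 of
      \<open>Pi_pmf\<close>.\<close>
    have "pmf (Pi_pmf (nodes G) 0 (node_law G)) n = (\<Prod>a\<in>stations G <+> routes G. pmf (node_law G a) (n a))"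
      using n fin by (subst pmf_Pi') (auto simp: state_space_def nodes_def)
    also have "\<dots> = (\<Prod>j\<in>stations G. pmf (node_law G (Inl j)) (n (Inl j)))
        * (\<Prod>e\<in>routes G. pmf (node_law G (Inr e)) (n (Inr e)))"
      using fin by (simp add: prod.Plus del: node_law.simps)
    also have "\<dots> = \<kappa> * product_weight G n"
      by (simp only: st rt prod.distrib \<kappa>_def gM product_weight_def cong: prod.cong) (simp only: mult_ac)
    finally show ?thesis .
  qed
  ultimately show ?thesis by blast
qed

text \<open>The two weights are proportional on the state space, and given the total the independent
  nodes almost surely form a state: the capacities are built into the truncated laws and the default
  value is 0 off the nodes. The factor \<kappa> cancels in the quotient.\<close>

lemma prob_product_form:
  assumes G: "bike_network G" "bikes G > 0"
  defines "Q \<equiv> Pi_pmf (nodes G) 0 (node_law G)"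
  shows "measure_pmf.prob (product_form G) B
    = measure_pmf.prob Q (B \<inter> {x. sum x (nodes G) = bikes G}) / measure_pmf.prob Q {x. sum x (nodes G) = bikes G}"
proof -
  let ?S = "state_space G" and ?E = "{x. sum x (nodes G) = bikes G}"
  note fin = bike_network_finite[OF G(1)]
  have fS: "finite ?S" by (rule finite_state_space[OF fin(1)])
  obtain \<kappa> where k: "\<kappa> > 0" "\<And>n. n \<in> ?S \<Longrightarrow> pmf Q n = \<kappa> * product_weight G n"
    using pmf_Pi_node_law[OF G] unfolding Q_def by blast
  have sub: "?S \<subseteq> ?E" by (auto simp: state_space_def)
  have "x \<in> ?S" if "x \<in> ?E" "x \<in> set_pmf Q" for x
  proof -
    have "\<forall>a. a \<notin> nodes G \<longrightarrow> x a = 0" "\<forall>a\<in>nodes G. x a \<in> set_pmf (node_law G a)"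
      using that(2) fin by (auto simp: Q_def set_Pi_pmf PiE_dflt_def)
    moreover from this(2) have "x (Inl j) \<le> station_capacity G j" if "j \<in> stations G" for j
      using set_node_law_station[OF G(1) that] that by (auto simp: nodes_def simp del: node_law.simps)
    ultimately show ?thesis using that(1) by (simp add: state_space_def)
  qed
  then have Q: "measure_pmf.prob Q (X \<inter> ?E) = (\<Sum>n\<in>X \<inter> ?S. \<kappa> * product_weight G n)" for X
  proof -
    have "measure_pmf.prob Q (X \<inter> ?E) = measure_pmf.prob Q (X \<inter> ?S)"
      using sub \<open>\<And>x. x \<in> ?E \<Longrightarrow> x \<in> set_pmf Q \<Longrightarrow> x \<in> ?S\<close>
      by (intro measure_prob_cong_0) (auto simp: set_pmf_iff)
    also have "\<dots> = (\<Sum>n\<in>X \<inter> ?S. pmf Q n)" using fS by (simp add: measure_measure_pmf_finite)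
    finally show ?thesis by (simp add: k(2))
  qed
  have "measure_pmf.prob (product_form G) B = measure_pmf.prob (product_form G) (B \<inter> ?S)"
    by (intro measure_prob_cong_0) (auto simp: pmf_product_form[OF G(1)])
  also have "\<dots> = (\<Sum>n\<in>B \<inter> ?S. pmf (product_form G) n)"
    using fS by (simp add: measure_measure_pmf_finite)
  also have "\<dots> = (\<Sum>n\<in>B \<inter> ?S. product_weight G n) / partition_function G"
    by (simp add: pmf_product_form[OF G(1)] sum_divide_distrib)
  also have "\<dots> = (\<Sum>n\<in>B \<inter> ?S. \<kappa> * product_weight G n) / (\<Sum>n\<in>?S. \<kappa> * product_weight G n)"
    using k(1) by (simp add: partition_function_def flip: sum_distrib_left)
  finally show ?thesis using Q[of B] Q[of UNIV] by simp
qed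

lemma prob_product_form_coordinates:
  assumes G: "bike_network G" "bikes G > 0" and A: "A \<subseteq> nodes G" and k: "sum m A \<le> bikes G"
  shows "measure_pmf.prob (product_form G) {x. \<forall>a\<in>A. x a = m a}
    = (\<Prod>a\<in>A. pmf (node_law G a) (m a)) * pmf (indep_sum (nodes G - A) (node_law G)) (bikes G - sum m A)
      / pmf (indep_sum (nodes G) (node_law G)) (bikes G)"
proof -
  note fin = bike_network_finite(3)[OF G(1)]
  show ?thesis
    \<comment> \<open>The same formula serves twice: with \<open>A\<close> for the numerator and
      with \<open>{}\<close> for the probability of the total.\<close>
    using prob_Pi_pmf_coordinates_and_sum[OF fin A k, of "node_law G"]
      prob_Pi_pmf_coordinates_and_sum[OF fin, of "{}" m "bikes G" "node_law G"]
    by (simp add: prob_product_form[OF G] Int_def)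
qed

section \<open>Order of magnitude of \<gamma>\<close>

lemma sum_flow:
  assumes G: "bike_network G"
  shows "(\<Sum>(i, j)\<in>routes G. inv_prob G i * routing G i j) = 1"
proof -
  let ?J = "stations G"
  note fin = bike_network_finite(1)[OF G]
  \<comment> \<open>The added pairs, the diagonal included, have routing probability 0.\<close>
  have "(\<Sum>(i, j)\<in>routes G. inv_prob G i * routing G i j)
    = (\<Sum>(i, j)\<in>?J \<times> ?J. inv_prob G i * routing G i j)"
    using fin G by (intro sum.mono_neutral_left)
      (force simp: routes_def bike_network_def stochastic_on_def)+
  also have "\<dots> = (\<Sum>i\<in>?J. inv_prob G i * (\<Sum>j\<in>?J. routing G i j))"
    by (simp add: sum_distrib_left flip: sum.cartesian_product)
  also have "\<dots> = (\<Sum>i\<in>?J. inv_prob G i)"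
    using G by (simp add: bike_network_def stochastic_on_def)
  finally show ?thesis using G by (simp add: bike_network_def invariant_prob_on_def)
qed

text \<open>The flows over the routes and the masses of the stations each sum to 1, so bounds on the
  service rates alone control the totals, uniformly in the network.\<close>

lemma sum_utilization_bounds:
  assumes G: "bike_network G"
    and lo: "\<mu>m > 0" "\<And>a. a \<in> nodes G \<Longrightarrow> \<mu>m \<le> service_rate G a"
    and hi: "\<mu>p > 0" "\<And>a. a \<in> nodes G \<Longrightarrow> service_rate G a \<le> \<mu>p"
  shows "1 / (2 * \<mu>p) \<le> (\<Sum>e\<in>routes G. utilization G (Inr e))"
    and "(\<Sum>e\<in>routes G. utilization G (Inr e)) \<le> 1 / (2 * \<mu>m)"
    and "(\<Sum>j\<in>stations G. utilization G (Inl j)) \<le> 1 / (2 * \<mu>m)"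
proof -
  let ?f = "\<lambda>(i, j). inv_prob G i * routing G i j"
  have f: "?f e \<ge> 0" "utilization G (Inr e) = ?f e / (2 * service_rate G (Inr e))"
    if "e \<in> routes G" for e
    using that bike_network_inv_prob_nonneg[OF G] by (auto simp: routes_def)
  have s: "\<mu>m \<le> service_rate G (Inr e)" "service_rate G (Inr e) \<le> \<mu>p" if "e \<in> routes G" for e
    using that lo hi by (auto simp: nodes_def)
  have summand: "?f e / (2 * \<mu>p) \<le> utilization G (Inr e)" "utilization G (Inr e) \<le> ?f e / (2 * \<mu>m)"
    if "e \<in> routes G" for e
    unfolding f(2)[OF that] using s[OF that] lo(1) hi(1)
    by (intro divide_left_mono f(1)[OF that] mult_pos_pos; linarith)+
  have "(\<Sum>e\<in>routes G. ?f e / (2 * \<mu>p)) \<le> (\<Sum>e\<in>routes G. utilization G (Inr e))"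
    by (intro sum_mono summand)
  then show "1 / (2 * \<mu>p) \<le> (\<Sum>e\<in>routes G. utilization G (Inr e))"
    by (simp add: sum_flow[OF G] flip: sum_divide_distrib)
  have "(\<Sum>e\<in>routes G. utilization G (Inr e)) \<le> (\<Sum>e\<in>routes G. ?f e / (2 * \<mu>m))"
    by (intro sum_mono summand)
  then show "(\<Sum>e\<in>routes G. utilization G (Inr e)) \<le> 1 / (2 * \<mu>m)"
    by (simp add: sum_flow[OF G] flip: sum_divide_distrib)
  have "(\<Sum>j\<in>stations G. utilization G (Inl j)) \<le> (\<Sum>j\<in>stations G. inv_prob G j / (2 * \<mu>m))"
  proof (intro sum_mono)
    fix j assume j: "j \<in> stations G"
    then have "\<mu>m \<le> service_rate G (Inl j)" using lo(2) by (auto simp: nodes_def)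
    then show "utilization G (Inl j) \<le> inv_prob G j / (2 * \<mu>m)"
      using lo(1) bike_network_inv_prob_nonneg[OF G j] by (auto intro!: divide_left_mono mult_pos_pos)
  qed
  then show "(\<Sum>j\<in>stations G. utilization G (Inl j)) \<le> 1 / (2 * \<mu>m)"
    using G by (simp add: bike_network_def invariant_prob_on_def flip: sum_divide_distrib)
qed

text \<open>For \<open>1 \<le> n \<le> c\<close> the term \<open>n * x ^ n\<close> is at most
  \<open>c * x * x ^ (n - 1)\<close>, and the powers \<open>x ^ (n - 1)\<close> are among those in
  the denominator.\<close>

lemma truncated_geometric_mean_le:
  fixes x :: real
  assumes "x \<ge> 0"
  shows "(\<Sum>n\<le>c. real n * x ^ n) / (\<Sum>n\<le>c. x ^ n) \<le> real c * x"
proof -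
  have "(\<Sum>n\<le>c. x ^ n) > 0" using assms by (intro sum_pos2[of _ 0]) auto
  moreover have "(\<Sum>n\<le>c. real n * x ^ n) \<le> real c * x * (\<Sum>n\<le>c. x ^ n)"
  proof (cases c)
    case (Suc d)
    have "(\<Sum>n\<le>c. real n * x ^ n) = (\<Sum>n\<le>d. real (Suc n) * x ^ Suc n)"
      unfolding Suc by (subst sum.atMost_Suc_shift) simp
    also have "\<dots> \<le> (\<Sum>n\<le>d. real c * x ^ Suc n)"
      using assms Suc by (intro sum_mono mult_right_mono) auto
    also have "\<dots> = real c * x * (\<Sum>n\<le>d. x ^ n)" by (simp add: sum_distrib_left mult.assoc)
    also have "\<dots> \<le> real c * x * (\<Sum>n\<le>c. x ^ n)"
      using assms Suc by (intro mult_left_mono sum_mono2) auto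
    finally show ?thesis .
  qed simp
  ultimately show ?thesis by (simp add: divide_le_eq)
qed

text \<open>Dropping the station means from the equation for \<gamma> gives the upper bound. For the
  lower one, each station mean is at most \<open>C * x j\<close>, so the whole left-hand side is at
  most \<open>\<gamma> * (C + 1) / (2 * \<mu>m)\<close>.\<close>

lemma gamma_bounds:
  assumes G: "bike_network G"
    and lo: "\<mu>m > 0" "\<And>a. a \<in> nodes G \<Longrightarrow> \<mu>m \<le> service_rate G a"
    and hi: "\<mu>p > 0" "\<And>a. a \<in> nodes G \<Longrightarrow> service_rate G a \<le> \<mu>p"
    and cap: "\<And>j. j \<in> stations G \<Longrightarrow> station_capacity G j \<le> C"
  shows "2 * \<mu>m / (real C + 1) * real (bikes G) \<le> gamma G" and "gamma G \<le> 2 * \<mu>p * real (bikes G)"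
proof -
  define x where "x j = gamma G * utilization G (Inl j)" for j
  define E where "E j = (\<Sum>n\<le>station_capacity G j. real n * x j ^ n) / (\<Sum>n\<le>station_capacity G j. x j ^ n)" for j
  define R where "R = (\<Sum>e\<in>routes G. utilization G (Inr e))"
  note R = sum_utilization_bounds(1,2)[OF G lo hi, folded R_def]
  note g = gamma_nonneg[OF G]
  have x0: "x j \<ge> 0" if "j \<in> stations G" for j
    using that g utilization_nonneg[OF G, of "Inl j"]
    by (simp add: x_def del: utilization.simps)
  have eq: "(\<Sum>j\<in>stations G. E j) + gamma G * R = real (bikes G)"
    using gamma_eq_gamma[OF G] unfolding gamma_eq_def E_def x_def R_def sum_distrib_left .
  have "E j \<ge> 0" if "j \<in> stations G" for j
    unfolding E_def using x0[OF that] by (intro divide_nonneg_nonneg sum_nonneg) auto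
  then have "gamma G * R \<le> real (bikes G)" using eq sum_nonneg[of "stations G" E] by simp
  moreover have "gamma G * (1 / (2 * \<mu>p)) \<le> gamma G * R" using R(1) g by (intro mult_left_mono)
  ultimately have "gamma G * (1 / (2 * \<mu>p)) \<le> real (bikes G)" by linarith
  then show "gamma G \<le> 2 * \<mu>p * real (bikes G)" using hi(1) by (simp add: field_simps)
  have "E j \<le> real C * x j" if "j \<in> stations G" for j
  proof -
    have "E j \<le> real (station_capacity G j) * x j"
      unfolding E_def by (rule truncated_geometric_mean_le[OF x0[OF that]])
    also have "\<dots> \<le> real C * x j" using cap[OF that] x0[OF that] by (intro mult_right_mono) auto
    finally show ?thesis .
  qed
  then have "(\<Sum>j\<in>stations G. E j) \<le> (\<Sum>j\<in>stations G. real C * x j)" by (rule sum_mono)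
  also have "\<dots> = real C * (gamma G * (\<Sum>j\<in>stations G. utilization G (Inl j)))"
    unfolding x_def by (simp only: sum_distrib_left)
  also have "\<dots> \<le> real C * (gamma G * (1 / (2 * \<mu>m)))"
    using sum_utilization_bounds(3)[OF G lo hi] g by (intro mult_left_mono) auto
  finally have "real (bikes G) \<le> real C * (gamma G * (1 / (2 * \<mu>m))) + gamma G * (1 / (2 * \<mu>m))"
    using eq mult_left_mono[OF R(2) g] by linarith
  then show "2 * \<mu>m / (real C + 1) * real (bikes G) \<le> gamma G"
    using lo(1) by (simp add: field_simps)
qed

section \<open>Local limit estimates\<close>

lemma mean_node_law:
  assumes G: "bike_network G" "bikes G > 0" and a: "a \<in> nodes G"
    and cap: "\<And>j. j \<in> stations G \<Longrightarrow> station_capacity G j \<le> C"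
    and D: "D \<ge> 0" "\<And>e. e \<in> routes G \<Longrightarrow> gamma G * utilization G (Inr e) \<le> D"
  shows "integrable (node_law G a) real"
    and "measure_pmf.expectation (node_law G a) real \<le> real C + D"
proof -
  have "integrable (node_law G a) real \<and> measure_pmf.expectation (node_law G a) real \<le> real C + D"
  proof (cases a)
    case (Inl j)
    then have j: "j \<in> stations G" using a by simp
    have s: "set_pmf (node_law G a) \<subseteq> {..C}"
      using set_node_law_station[OF G(1) j] cap[OF j] Inl by (auto simp del: node_law.simps)
    then have i: "integrable (node_law G a) f" for f :: "nat \<Rightarrow> real"
      by (intro integrable_measure_pmf_finite) (auto intro: finite_subset)
    have "measure_pmf.expectation (node_law G a) real \<le> measure_pmf.expectation (node_law G a) (\<lambda>_. real C)"
      using s by (intro integral_mono_AE i) (auto simp: AE_measure_pmf_iff)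
    then show ?thesis using i D(1) by simp
  next
    case (Inr e)
    then have e: "e \<in> routes G" using a by simp
    have "gamma G * utilization G (Inr e) > 0"
      using gamma_pos[OF G] utilization_pos[OF G(1), of "Inr e"] e by (simp del: utilization.simps)
    then show ?thesis
      using D(2)[OF e] unfolding Inr node_law_route[OF G e]
      by (simp add: integrable_poisson expectation_poisson del: utilization.simps)
  qed
  then show "integrable (node_law G a) real" "measure_pmf.expectation (node_law G a) real \<le> real C + D"
    by auto
qed

text \<open>The independent Poisson routes merge into one Poisson variable and the bounded stations
  form the second summand, the shape that the estimates on sums with a Poisson summand
  require.\<close>

lemma indep_sum_routes_stations:
  assumes G: "bike_network G" "bikes G > 0" and J: "J \<subseteq> stations G" and R: "R \<subseteq> routes G" "R \<noteq> {}"
  shows "indep_sum (J <+> R) (node_law G) = map_pmf (\<lambda>(x, y). x + y)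
    (pair_pmf (poisson_pmf (gamma G * (\<Sum>e\<in>R. utilization G (Inr e)))) (indep_sum (Inl ` J) (node_law G)))"
proof -
  have fin: "finite J" "finite R" using J R bike_network_finite[OF G(1)] by (auto intro: finite_subset)
  have "indep_sum (Inr ` R) (node_law G) = poisson_pmf (\<Sum>a\<in>Inr ` R. gamma G * utilization G a)"
  proof (rule indep_sum_poisson)
    fix a :: "'a node" assume "a \<in> Inr ` R"
    then obtain e where e: "a = Inr e" "e \<in> routes G" using R by auto
    then show "0 < gamma G * utilization G a"
      using gamma_pos[OF G] utilization_pos[OF G(1), of a] by (simp del: utilization.simps)
    show "node_law G a = poisson_pmf (gamma G * utilization G a)"
      unfolding e(1) by (rule node_law_route[OF G e(2)])
  qed (use fin R in auto)
  moreover have "(\<Sum>a\<in>Inr ` R. gamma G * utilization G a) = gamma G * (\<Sum>e\<in>R. utilization G (Inr e))"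
    by (simp add: sum.reindex sum_distrib_left del: utilization.simps)
  moreover have "J <+> R = Inr ` R \<union> Inl ` J" by auto
  ultimately show ?thesis using indep_sum_union[of "Inr ` R" "Inl ` J" "node_law G"] fin by auto
qed

text \<open>The nodes in \<open>A\<close> are the summand to be removed, of mean at most
  \<open>card A * (C + D)\<close>. What remains still contains a Poisson variable of parameter at
  least \<open>r\<close>, since removing \<open>A\<close> costs at most
  \<open>card A * D\<close>.\<close>

lemma pmf_indep_sum_nodes_diff_le:
  assumes G: "bike_network G" "bikes G > 0" and A: "A \<subseteq> nodes G" and k: "k \<le> bikes G"
    and cap: "\<And>j. j \<in> stations G \<Longrightarrow> station_capacity G j \<le> C"
    and D: "D \<ge> 0" "\<And>e. e \<in> routes G \<Longrightarrow> gamma G * utilization G (Inr e) \<le> D"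
    and r: "r > 0" "r + real (card A) * D \<le> gamma G * (\<Sum>e\<in>routes G. utilization G (Inr e))"
  shows "\<bar>pmf (indep_sum (nodes G) (node_law G)) (bikes G)
      - pmf (indep_sum (nodes G - A) (node_law G)) (bikes G - k)\<bar>
    \<le> (real (card A) * (real C + D) + real k) / r"
proof -
  define J where "J = {j \<in> stations G. Inl j \<notin> A}"
  define R where "R = {e \<in> routes G. Inr e \<notin> A}"
  define R' where "R' = {e \<in> routes G. Inr e \<in> A}"
  define \<rho> where "\<rho> = gamma G * (\<Sum>e\<in>R. utilization G (Inr e))"
  note fin = bike_network_finite[OF G(1)]
  have fA: "finite A" using A fin(3) by (rule finite_subset)
  have JR: "nodes G - A = J <+> R" by (auto simp: nodes_def J_def R_def)
  have "(\<Sum>e\<in>routes G. utilization G (Inr e)) = (\<Sum>e\<in>R. utilization G (Inr e)) + (\<Sum>e\<in>R'. utilization G (Inr e))"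
    using fin by (subst sum.union_disjoint[symmetric]) (auto simp: R_def R'_def intro!: sum.cong)
  then have "gamma G * (\<Sum>e\<in>routes G. utilization G (Inr e))
    = \<rho> + (\<Sum>e\<in>R'. gamma G * utilization G (Inr e))"
    by (simp add: \<rho>_def distrib_left sum_distrib_left)
  also have "(\<Sum>e\<in>R'. gamma G * utilization G (Inr e)) \<le> real (card R') * D"
    using D(2) by (intro sum_bounded_above) (auto simp: R'_def)
  also have "card R' = card (Inr ` R' :: 'a node set)" by (simp add: card_image)
  also have "\<dots> \<le> card A" using fA by (intro card_mono) (auto simp: R'_def)
  finally have rho: "\<rho> \<ge> r" using r(2) D(1) by (simp add: mult_right_mono)
  then have "R \<noteq> {}" using r(1) by (auto simp: \<rho>_def)
  then have V: "indep_sum (nodes G - A) (node_law G) = map_pmf (\<lambda>(x, y). x + y)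
      (pair_pmf (poisson_pmf \<rho>) (indep_sum (Inl ` J) (node_law G)))"
    unfolding JR \<rho>_def by (intro indep_sum_routes_stations G) (auto simp: J_def R_def)
  have "nodes G = (nodes G - A) \<union> A" "(nodes G - A) \<inter> A = {}" using A by auto
  then have S: "indep_sum (nodes G) (node_law G) = map_pmf (\<lambda>(x, y). x + y)
      (pair_pmf (indep_sum (nodes G - A) (node_law G)) (indep_sum A (node_law G)))"
    using indep_sum_union[of "nodes G - A" A "node_law G"] fin fA by simp
  have mean: "integrable (node_law G a) real" "measure_pmf.expectation (node_law G a) real \<le> real C + D"
    if "a \<in> A" for a
    using mean_node_law[OF G _ cap D, of a] that A by blast+
  have "measure_pmf.expectation (indep_sum A (node_law G)) real \<le> real (card A) * (real C + D)"
  proof -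
    have "(\<Sum>a\<in>A. measure_pmf.expectation (node_law G a) real) \<le> real (card A) * (real C + D)"
      by (rule sum_bounded_above) (rule mean(2))
    then show ?thesis by (simp only: expectation_indep_sum[OF fA mean(1)])
  qed
  then have "(measure_pmf.expectation (indep_sum A (node_law G)) real + real k) / r
      \<le> (real (card A) * (real C + D) + real k) / r"
    using r(1) by (intro divide_right_mono add_right_mono) auto
  moreover have "\<bar>pmf (indep_sum (nodes G) (node_law G)) (bikes G)
      - pmf (indep_sum (nodes G - A) (node_law G)) (bikes G - k)\<bar>
    \<le> (measure_pmf.expectation (indep_sum A (node_law G)) real + real k) / \<rho>"
    unfolding S unfolding V
    by (rule pmf_add_poisson_diff_le) (use rho r k integrable_indep_sum[OF fA mean(1)] in auto)
  moreover have "\<dots> \<le> (measure_pmf.expectation (indep_sum A (node_law G)) real + real k) / r"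
    using rho r by (intro divide_left_mono add_nonneg_nonneg) auto
  ultimately show ?thesis by linarith
qed

text \<open>An instance of \<open>pmf_add_poisson_ge\<close> with \<open>c = C + 1\<close>, which is
  positive even if \<open>C = 0\<close>.\<close>

lemma pmf_indep_sum_nodes_ge:
  assumes G: "bike_network G" "bikes G > 0"
    and cap: "\<And>j. j \<in> stations G \<Longrightarrow> station_capacity G j \<le> C"
    and r: "1 + sqrt (2 * (real C + 1) * real (bikes G)) \<le> r"
      "r \<le> gamma G * (\<Sum>e\<in>routes G. utilization G (Inr e))"
  shows "pmf (indep_sum (nodes G) (node_law G)) (bikes G)
    \<ge> exp (- 2 * (real C + 1) * real (bikes G) / r - 1) / (2 * sqrt (real (bikes G)))"
proof -
  let ?\<rho> = "gamma G * (\<Sum>e\<in>routes G. utilization G (Inr e))"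
  let ?J = "Inl ` stations G :: 'a node set"
  let ?w = "indep_sum ?J (node_law G)"
  note fin = bike_network_finite[OF G(1)]
  have "0 \<le> sqrt (2 * (real C + 1) * real (bikes G))" by simp
  then have r0: "r > 0" using r by linarith
  obtain e where "e \<in> routes G" using exists_busy_route[OF G(1)] by blast
  then have S: "indep_sum (nodes G) (node_law G) = map_pmf (\<lambda>(x, y). x + y) (pair_pmf (poisson_pmf ?\<rho>) ?w)"
    unfolding nodes_def by (intro indep_sum_routes_stations G) auto
  have b: "set_pmf (node_law G a) \<subseteq> {..C}" if a: "a \<in> ?J" for a
  proof -
    obtain j where j: "a = Inl j" "j \<in> stations G" using a by auto
    show ?thesis using set_node_law_station[OF G(1) j(2)] cap[OF j(2)] unfolding j(1) by (auto simp del: node_law.simps)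
  qed
  have f: "finite (set_pmf (node_law G a))" if "a \<in> ?J" for a
    using b[OF that] by (rule finite_subset) simp
  have "set_pmf ?w \<subseteq> {..card ?J * C}" by (rule set_indep_sum_le) (use b fin in auto)
  then have fw: "finite (set_pmf ?w)" by (rule finite_subset) simp
  have Ew: "measure_pmf.expectation ?w real = (\<Sum>a\<in>?J. measure_pmf.expectation (node_law G a) real)"
    using fin f by (intro expectation_indep_sum integrable_measure_pmf_finite) auto
  also have "\<dots> = (\<Sum>j\<in>stations G. measure_pmf.expectation (node_law G (Inl j)) real)"
    by (simp add: sum.reindex del: node_law.simps)
  also have "\<dots> = (\<Sum>j\<in>stations G.
      (\<Sum>n\<le>station_capacity G j. real n * (gamma G * utilization G (Inl j)) ^ n) /
      (\<Sum>n\<le>station_capacity G j. (gamma G * utilization G (Inl j)) ^ n))"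
    by (intro sum.cong refl expectation_node_law_station G)
  \<comment> \<open>The equation defining \<gamma> says precisely that the independent nodes hold
    \<open>M\<close> bikes on average.\<close>
  finally have mean: "?\<rho> + measure_pmf.expectation ?w real = real (bikes G)"
    using gamma_eq_gamma[OF G(1)] unfolding gamma_eq_def sum_distrib_left by linarith
  have "measure_pmf.variance ?w real \<le> real C * measure_pmf.expectation ?w real"
    unfolding Ew using fin b by (intro second_moment_indep_sum) auto
  also have "\<dots> \<le> (real C + 1) * real (bikes G)"
    using mean r(2) r0 by (intro mult_mono) auto
  finally have var: "measure_pmf.variance ?w real \<le> (real C + 1) * real (bikes G)" .
  \<comment> \<open>The bound increases with the Poisson parameter, which may thus be replaced by
    its lower bound \<open>r\<close>.\<close>
  have "2 * (real C + 1) * real (bikes G) / ?\<rho> \<le> 2 * (real C + 1) * real (bikes G) / r"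
    using r r0 by (intro divide_left_mono) auto
  moreover have "- 2 * (real C + 1) * real (bikes G) / x = - (2 * (real C + 1) * real (bikes G) / x)" for x
    by (simp only: mult_minus_left divide_minus_left)
  ultimately have "exp (- 2 * (real C + 1) * real (bikes G) / r - 1)
      \<le> exp (- 2 * (real C + 1) * real (bikes G) / ?\<rho> - 1)"
    unfolding exp_le_cancel_iff by linarith
  then have "exp (- 2 * (real C + 1) * real (bikes G) / r - 1) / (2 * sqrt (real (bikes G)))
    \<le> exp (- 2 * (real C + 1) * real (bikes G) / ?\<rho> - 1) / (2 * sqrt (real (bikes G)))"
    by (intro divide_right_mono) auto
  also have "\<dots> \<le> pmf (indep_sum (nodes G) (node_law G)) (bikes G)"
    unfolding S by (rule pmf_add_poisson_ge) (use r r0 fw mean var in auto)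
  finally show ?thesis .
qed

text \<open>Divides the difference estimate by the lower bound on \<open>P(S = M)\<close>. The
  former is used with \<open>r = h * M - card A * D\<close>, what is left of the Poisson parameter
  without \<open>A\<close>, the latter with \<open>r = h * M\<close>.\<close>

lemma pmf_indep_sum_ratio:
  assumes G: "bike_network G" "bikes G > 0" and A: "A \<subseteq> nodes G" and k: "k \<le> bikes G"
    and cap: "\<And>j. j \<in> stations G \<Longrightarrow> station_capacity G j \<le> C"
    and D: "D \<ge> 0" "\<And>e. e \<in> routes G \<Longrightarrow> gamma G * utilization G (Inr e) \<le> D"
    and h: "h > 0" "h * real (bikes G) \<le> gamma G * (\<Sum>e\<in>routes G. utilization G (Inr e))"
    and big: "1 + sqrt (2 * (real C + 1) * real (bikes G)) \<le> h * real (bikes G)"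
      "real (card A) * D < h * real (bikes G)"
  shows "\<bar>pmf (indep_sum (nodes G - A) (node_law G)) (bikes G - k)
      / pmf (indep_sum (nodes G) (node_law G)) (bikes G) - 1\<bar>
    \<le> (real (card A) * (real C + D) + real k) / (h * real (bikes G) - real (card A) * D)
      * (2 * sqrt (real (bikes G)) * exp (2 * (real C + 1) / h + 1))"
proof -
  let ?S = "pmf (indep_sum (nodes G) (node_law G)) (bikes G)"
  let ?V = "pmf (indep_sum (nodes G - A) (node_law G)) (bikes G - k)"
  let ?M = "real (bikes G)"
  let ?x = "(real (card A) * (real C + D) + real k) / (h * ?M - real (card A) * D)"
  let ?y = "exp (- 2 * (real C + 1) * ?M / (h * ?M) - 1) / (2 * sqrt ?M)"
  have y: "?y > 0" using G(2) by simp
  have S: "?S \<ge> ?y" by (rule pmf_indep_sum_nodes_ge[OF G cap big(1) h(2)])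
  have d: "\<bar>?S - ?V\<bar> \<le> ?x"
    by (rule pmf_indep_sum_nodes_diff_le[OF G A k cap D]; (use big h in linarith)?)
  have S0: "?S > 0" using S y by linarith
  then have "?V / ?S - 1 = (?V - ?S) / ?S" by (simp add: diff_divide_distrib)
  then have "\<bar>?V / ?S - 1\<bar> = \<bar>?S - ?V\<bar> / ?S"
    using S0 abs_minus_commute[of ?V ?S] by simp
  also have "\<dots> \<le> ?x / ?y" using d S y by (intro frac_le) linarith+
  also have "?x / ?y = ?x * (1 / ?y)" by simp
  finally have bound: "\<bar>?V / ?S - 1\<bar> \<le> ?x * (1 / ?y)" .
  \<comment> \<open>\<open>M\<close> cancels, so the exponential depends on \<open>C\<close> and
    \<open>h\<close> only.\<close>
  have e: "- 2 * (real C + 1) * ?M / (h * ?M) - 1 = - (2 * (real C + 1) / h + 1)"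
    using G(2) h(1) by (simp add: field_simps)
  have "1 / (exp (- t) / (2 * s)) = 2 * s * exp t" for s t :: real
    by (simp add: exp_minus inverse_eq_divide)
  from this[of "2 * (real C + 1) / h + 1" "sqrt ?M"] show ?thesis
    using bound unfolding e by (simp only:)
qed

lemma route_mean_le:
  assumes G: "bike_network G" and e: "e \<in> routes G"
    and lo: "\<mu>m > 0" "\<And>a. a \<in> nodes G \<Longrightarrow> \<mu>m \<le> service_rate G a"
    and g: "gamma G \<le> b" and flow: "Max ((\<lambda>(i, j). inv_prob G i * routing G i j) ` routes G) \<le> B"
  shows "gamma G * utilization G (Inr e) \<le> b * (B / (2 * \<mu>m))"
proof -
  obtain i j where ij: "e = (i, j)" by (cases e)
  have n: "0 \<le> inv_prob G i * routing G i j"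
    using e bike_network_inv_prob_nonneg[OF G, of i] by (simp add: ij routes_def)
  have "inv_prob G i * routing G i j \<le> Max ((\<lambda>(i, j). inv_prob G i * routing G i j) ` routes G)"
    using bike_network_finite(2)[OF G] e by (intro Max_ge) (auto simp: ij intro: image_eqI[of _ _ "(i, j)"])
  then have "inv_prob G i * routing G i j \<le> B" using flow by linarith
  moreover have "\<mu>m \<le> service_rate G (Inr e)" using lo(2) e by simp
  ultimately have "utilization G (Inr e) \<le> B / (2 * \<mu>m)"
    using lo(1) n unfolding ij utilization.simps by (intro frac_le) auto
  moreover have "utilization G (Inr e) \<ge> 0" using utilization_nonneg[OF G, of "Inr e"] e by simp
  ultimately show ?thesis using g gamma_nonneg[OF G] by (intro mult_mono) auto
qed

section \<open>Passing to the limit along the sequence of networks\<close>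

theorem corollary5p2:
  fixes G :: "nat \<Rightarrow> 'a bike_network"
    and T :: "nat \<Rightarrow> real \<Rightarrow> 'a state \<Rightarrow> 'a state pmf"
    and \<xi> :: "nat \<Rightarrow> 'a state pmf"
    and N0 C :: nat
    and \<mu>_minus \<mu>_plus A :: real
  assumes network: "\<And>N. N \<ge> N0 \<Longrightarrow> bike_network (G N)"
    and num_nodes: "\<And>N. N \<ge> N0 \<Longrightarrow> card (nodes (G N)) = N"
    and dynamics: "\<And>N. N \<ge> N0 \<Longrightarrow> markov_semigroup (state_space (G N)) (T N)"
    and stationary: "\<And>N. N \<ge> N0 \<Longrightarrow> stationary_distribution (state_space (G N)) (T N) (\<xi> N)"
    and law: "\<And>N. N \<ge> N0 \<Longrightarrow> \<xi> N = product_form (G N)"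
    and capacity_bound:
      "\<And>N j. N \<ge> N0 \<Longrightarrow> j \<in> stations (G N) \<Longrightarrow> station_capacity (G N) j \<le> C"
    and "\<mu>_minus > 0" and "\<mu>_plus > 0"
    and rate_bounds:
      "\<And>N a. N \<ge> N0 \<Longrightarrow> a \<in> nodes (G N) \<Longrightarrow>
         \<mu>_minus \<le> service_rate (G N) a \<and> service_rate (G N) a \<le> \<mu>_plus"
    and "A > 0"
    and flow_bound:
      "\<And>N. N \<ge> N0 \<Longrightarrow>
         Max ((\<lambda>(i, j). inv_prob (G N) i * routing (G N) i j) ` routes (G N))
           \<le> A / real (card (routes (G N)))"
    and bikes_infinite: "filterlim (\<lambda>N. bikes (G N)) at_top sequentially"
    and bikes_growth: "(\<lambda>N. real (bikes (G N)) / real (card (routes (G N))) ^ 2) \<longlonglongrightarrow> 0"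
  shows "(\<forall>K\<ge>1. \<forall>(a :: nat \<Rightarrow> nat \<Rightarrow> 'a node) (n :: nat \<Rightarrow> nat).
            (\<forall>\<^sub>F N in sequentially.
               inj_on (a N) {1..K} \<and> a N ` {1..K} \<subseteq> nodes (G N)) \<longrightarrow>
            (\<lambda>N. if \<exists>l\<in>{1..K}. enat (n l) > capacity (G N) (a N l) then 1
                 else measure_pmf.prob (\<xi> N) {x. \<forall>l\<in>{1..K}. x (a N l) = n l} /
                      (\<Prod>l=1..K. pmf (node_law (G N) (a N l)) (n l))) \<longlonglongrightarrow> 1)
       \<and> (\<exists>\<alpha> \<beta>. 0 < \<alpha> \<and> \<alpha> \<le> \<beta> \<and>
            (\<forall>N\<ge>N0. \<alpha> * real (bikes (G N)) \<le> gamma (G N) \<and>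
                     gamma (G N) \<le> \<beta> * real (bikes (G N))))"
proof -
  define M where "M N = real (bikes (G N))" for N
  define J where "J N = real (card (routes (G N)))" for N
  note low = rate_bounds[THEN conjunct1] and high = rate_bounds[THEN conjunct2]
  define \<alpha> where "\<alpha> = 2 * \<mu>_minus / (real C + 1)"
  \<comment> \<open>The maximum with \<alpha> gives \<open>\<alpha> \<le> \<beta>\<close>
    outright.\<close>
  define \<beta> where "\<beta> = max \<alpha> (2 * \<mu>_plus)"
  have a0: "\<alpha> > 0" using \<open>\<mu>_minus > 0\<close> by (simp add: \<alpha>_def)
  have gamma_order: "\<alpha> * M N \<le> gamma (G N)" "gamma (G N) \<le> 2 * \<mu>_plus * M N" if "N \<ge> N0" for N
    unfolding \<alpha>_def M_def
    by (rule gamma_bounds[OF network[OF that] \<open>\<mu>_minus > 0\<close> low[OF that] \<open>\<mu>_plus > 0\<close> high[OF that]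
        capacity_bound[OF that]]; assumption)+
  have "gamma (G N) \<le> \<beta> * M N" if "N \<ge> N0" for N
    using gamma_order(2)[OF that] mult_right_mono[of "2 * \<mu>_plus" \<beta> "M N"] by (simp add: \<beta>_def M_def)
  then have order: "\<exists>\<alpha> \<beta>. 0 < \<alpha> \<and> \<alpha> \<le> \<beta> \<and>
      (\<forall>N\<ge>N0. \<alpha> * real (bikes (G N)) \<le> gamma (G N) \<and> gamma (G N) \<le> \<beta> * real (bikes (G N)))"
    using a0 gamma_order(1) unfolding M_def by (intro exI[of _ \<alpha>] exI[of _ \<beta>]) (auto simp: \<beta>_def)

  \<comment> \<open>The total Poisson parameter is at least \<open>\<alpha> * M\<close> times the
    lower bound \<open>1 / (2 * \<mu>_plus)\<close> on the sum of the route utilizations.\<close>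
  define h where "h = \<alpha> / (2 * \<mu>_plus)"
  have h0: "h > 0" using a0 \<open>\<mu>_plus > 0\<close> by (simp add: h_def)
  \<comment> \<open>Bounds the mean of any single route: \<gamma> is at most
    \<open>2 * \<mu>_plus * M\<close>, a utilization at most
    \<open>A / J / (2 * \<mu>_minus)\<close>.\<close>
  define D where "D N = 2 * \<mu>_plus * M N * (A / J N / (2 * \<mu>_minus))" for N
  have D0: "D N \<ge> 0" for N
    unfolding D_def M_def J_def using \<open>\<mu>_plus > 0\<close> \<open>\<mu>_minus > 0\<close> \<open>A > 0\<close> by simp
  have D_route: "gamma (G N) * utilization (G N) (Inr e) \<le> D N" if "N \<ge> N0" "e \<in> routes (G N)" for N e
    unfolding D_def
    by (rule route_mean_le[OF network[OF that(1)] that(2) \<open>\<mu>_minus > 0\<close> low[OF that(1)] gamma_order(2)[OF that(1)]])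
      (use flow_bound[OF that(1)] in \<open>auto simp: J_def\<close>)
  have poisson_total: "h * M N \<le> gamma (G N) * (\<Sum>e\<in>routes (G N). utilization (G N) (Inr e))"
    if "N \<ge> N0" for N
  proof -
    have "h * M N = \<alpha> * M N * (1 / (2 * \<mu>_plus))" by (simp add: h_def)
    also have "\<dots> \<le> gamma (G N) * (\<Sum>e\<in>routes (G N). utilization (G N) (Inr e))"
      using sum_utilization_bounds(1)[OF network[OF that] \<open>\<mu>_minus > 0\<close> low[OF that] \<open>\<mu>_plus > 0\<close> high[OF that]]
        gamma_order(1)[OF that] gamma_nonneg[OF network[OF that]] \<open>\<mu>_plus > 0\<close>
      by (intro mult_mono) auto
    finally show ?thesis .
  qed

  have M_top: "filterlim M at_top sequentially"
    unfolding M_def by (rule filterlim_compose[OF filterlim_real_sequentially bikes_infinite])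
  have inv_sqrt: "(\<lambda>N. 1 / sqrt (M N)) \<longlonglongrightarrow> 0"
    by (rule real_tendsto_divide_at_top[OF tendsto_const filterlim_compose[OF sqrt_at_top M_top]])
  have M_pos: "\<forall>\<^sub>F N in sequentially. M N > 0" using M_top by (simp add: filterlim_at_top_dense)
  \<comment> \<open>Here the growth condition enters: \<open>D / sqrt M\<close> is a constant times
    \<open>sqrt (M / J^2)\<close>.\<close>
  have D_sqrt: "(\<lambda>N. D N / sqrt (M N)) \<longlonglongrightarrow> 0"
  proof -
    have "(\<lambda>N. \<mu>_plus * A / \<mu>_minus * sqrt (M N / J N ^ 2)) \<longlonglongrightarrow> \<mu>_plus * A / \<mu>_minus * sqrt 0"
      using bikes_growth unfolding M_def J_def by (intro tendsto_intros)
    moreover have "\<mu>_plus * A / \<mu>_minus * sqrt (M N / J N ^ 2) = D N / sqrt (M N)" for N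
    proof -
      have "M N = sqrt (M N) * sqrt (M N)" by (simp add: M_def)
      \<comment> \<open>For \<open>M N = 0\<close> both sides are 0, division by zero being
        0.\<close>
      then have "M N / sqrt (M N) = sqrt (M N)" by (metis nonzero_mult_div_cancel_left div_by_0 mult_zero_left)
      moreover have "sqrt (M N / J N ^ 2) = sqrt (M N) / J N" by (simp add: real_sqrt_divide J_def)
      moreover have "D N / sqrt (M N) = \<mu>_plus * A / \<mu>_minus * (M N / sqrt (M N) / J N)"
        by (simp add: D_def mult_ac)
      ultimately show ?thesis by simp
    qed
    ultimately show ?thesis by simp
  qed
  have D_M: "(\<lambda>N. D N / M N) \<longlonglongrightarrow> 0"
  proof -
    have "(\<lambda>N. D N / sqrt (M N) * (1 / sqrt (M N))) \<longlonglongrightarrow> 0 * 0"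
      by (intro tendsto_mult D_sqrt inv_sqrt)
    then show ?thesis by (simp add: M_def)
  qed

  have limit: "(\<lambda>N. if \<exists>l\<in>{1..K}. enat (n l) > capacity (G N) (a N l) then 1
       else measure_pmf.prob (\<xi> N) {x. \<forall>l\<in>{1..K}. x (a N l) = n l} /
            (\<Prod>l=1..K. pmf (node_law (G N) (a N l)) (n l))) \<longlonglongrightarrow> 1" (is "?ratio \<longlonglongrightarrow> 1")
    if ev: "\<forall>\<^sub>F N in sequentially. inj_on (a N) {1..K} \<and> a N ` {1..K} \<subseteq> nodes (G N)"
    for K :: nat and a :: "nat \<Rightarrow> nat \<Rightarrow> 'a node" and n :: "nat \<Rightarrow> nat"
  proof -
    define k where "k = (\<Sum>l=1..K. n l)"
    define err where "err N = (real K * (real C + D N) + real k) / (h * M N - real K * D N)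
      * (2 * sqrt (M N) * exp (2 * (real C + 1) / h + 1))" for N
    \<comment> \<open>This is \<open>err\<close> with the numerator divided by \<open>sqrt M\<close>
      and the denominator by \<open>M\<close>, which uses up the factor \<open>sqrt M\<close>. The
      new numerator tends to 0 and the new denominator to \<open>h\<close>.\<close>
    have "(\<lambda>N. (real K * (real C * (1 / sqrt (M N)) + D N / sqrt (M N)) + real k * (1 / sqrt (M N)))
        / (h - real K * (D N / M N)) * (2 * exp (2 * (real C + 1) / h + 1)))
      \<longlonglongrightarrow> (real K * (real C * 0 + 0) + real k * 0) / (h - real K * 0) * (2 * exp (2 * (real C + 1) / h + 1))"
      using h0 by (intro tendsto_intros inv_sqrt D_sqrt D_M) simp
    moreover have "\<forall>\<^sub>F N in sequentially. (real K * (real C * (1 / sqrt (M N)) + D N / sqrt (M N)) + real k * (1 / sqrt (M N)))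
        / (h - real K * (D N / M N)) * (2 * exp (2 * (real C + 1) / h + 1)) = err N"
      using M_pos
    proof eventually_elim
      case (elim N)
      define s where "s = sqrt (M N)"
      have s: "s > 0" "M N = s * s" using elim by (auto simp: s_def)
      have num: "real K * (real C * (1 / s) + D N / s) + real k * (1 / s) = (real K * (real C + D N) + real k) / s"
        by (simp add: add_divide_distrib distrib_left)
      have den: "h - real K * (D N / (s * s)) = (h * (s * s) - real K * D N) / (s * s)"
        using s by (simp add: diff_divide_distrib)
      have "x / s / (y / (s * s)) * (2 * z) = x / y * (2 * s * z)" for x y z :: real
        using s by simp
      then show ?case unfolding err_def s_def[symmetric] unfolding s(2) num den .
    qed
    ultimately have err: "err \<longlonglongrightarrow> 0" by (simp add: tendsto_cong)

    \<comment> \<open>The size condition \<open>1 + sqrt (2 * (C + 1) * M) \<le> h * M\<close> of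
      the ratio bound, divided by \<open>M\<close>.\<close>
    have "(\<lambda>N. (1 / sqrt (M N)) * (1 / sqrt (M N)) + sqrt (2 * (real C + 1)) * (1 / sqrt (M N)))
      \<longlonglongrightarrow> 0 * 0 + sqrt (2 * (real C + 1)) * 0"
      by (intro tendsto_intros inv_sqrt)
    then have big1: "\<forall>\<^sub>F N in sequentially.
        (1 / sqrt (M N)) * (1 / sqrt (M N)) + sqrt (2 * (real C + 1)) * (1 / sqrt (M N)) < h"
      using h0 by (intro order_tendstoD(2)) simp_all
    have "(\<lambda>N. real K * (D N / M N)) \<longlonglongrightarrow> real K * 0" by (intro tendsto_intros D_M)
    then have big2: "\<forall>\<^sub>F N in sequentially. real K * (D N / M N) < h"
      using h0 by (intro order_tendstoD(2)) simp_all
    have big3: "\<forall>\<^sub>F N in sequentially. k \<le> bikes (G N)"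
      using bikes_infinite by (simp add: filterlim_at_top)
    have "\<forall>\<^sub>F N in sequentially. norm (?ratio N - 1) \<le> \<bar>err N\<bar>"
      using ev eventually_ge_at_top[of N0] M_pos big1 big2 big3
    proof eventually_elim
      case (elim N)
      let ?F = "nodes (G N)" and ?A = "a N ` {1..K}" and ?p = "node_law (G N)"
      have G: "bike_network (G N)" "bikes (G N) > 0" using network elim(2,3) by (auto simp: M_def)
      have inj: "inj_on (a N) {1..K}" and A: "?A \<subseteq> ?F" using elim(1) by blast+
      \<comment> \<open>Transfers the prescribed values from the indices to the nodes, along the
        injective \<open>a N\<close>.\<close>
      define m where "m x = n (inv_into {1..K} (a N) x)" for x
      have m: "m (a N l) = n l" if "l \<in> {1..K}" for l using inj that by (simp add: m_def)
      have sm: "sum m ?A = k" unfolding k_def by (subst sum.reindex[OF inj]) (simp add: m)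
      have pm: "(\<Prod>x\<in>?A. pmf (?p x) (m x)) = (\<Prod>l=1..K. pmf (?p (a N l)) (n l))"
        by (subst prod.reindex[OF inj]) (simp add: m del: node_law.simps)
      have cA: "card ?A = K" using inj by (simp add: card_image)
      show ?case
      proof (cases "\<exists>l\<in>{1..K}. enat (n l) > capacity (G N) (a N l)")
        \<comment> \<open>Here the ratio is 1 by convention.\<close>
        case True
        then show ?thesis by simp
      next
        case False
        then have "pmf (?p (a N l)) (n l) > 0" if "l \<in> {1..K}" for l
          using that A by (intro pmf_node_law_pos G) (auto simp: not_less)
        then have P: "(\<Prod>l=1..K. pmf (?p (a N l)) (n l)) > 0" by (intro prod_pos) auto
        have "measure_pmf.prob (\<xi> N) {x. \<forall>l\<in>{1..K}. x (a N l) = n l}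
          = measure_pmf.prob (product_form (G N)) {x. \<forall>y\<in>?A. x y = m y}"
          using m by (simp add: law[OF elim(2)])
        also have "\<dots> = (\<Prod>l=1..K. pmf (?p (a N l)) (n l)) * pmf (indep_sum (?F - ?A) ?p) (bikes (G N) - k)
            / pmf (indep_sum ?F ?p) (bikes (G N))"
          using prob_product_form_coordinates[OF G A, of m] elim(6) unfolding sm pm by (simp only:)
        finally have prob: "measure_pmf.prob (\<xi> N) {x. \<forall>l\<in>{1..K}. x (a N l) = n l}
          = (\<Prod>l=1..K. pmf (?p (a N l)) (n l)) * pmf (indep_sum (?F - ?A) ?p) (bikes (G N) - k)
            / pmf (indep_sum ?F ?p) (bikes (G N))" .
        have cancel: "x * v / s / x = v / s" if "x > 0" for x v s :: real using that by simp
        \<comment> \<open>The product of the marginals cancels, leaving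
          \<open>P(S' = M - k) / P(S = M)\<close>.\<close>
        have ratio: "?ratio N = pmf (indep_sum (?F - ?A) ?p) (bikes (G N) - k) / pmf (indep_sum ?F ?p) (bikes (G N))"
          by (simp only: if_not_P[OF False] prob cancel[OF P])
        have big1: "1 + sqrt (2 * (real C + 1) * M N) \<le> h * M N"
        proof -
          define s where "s = sqrt (M N)"
          have s: "s > 0" "M N = s * s" using elim(3) by (auto simp: s_def)
          have "((1 / s) * (1 / s) + sqrt (2 * (real C + 1)) * (1 / s)) * (s * s) \<le> h * (s * s)"
            using elim(4) by (intro mult_right_mono) (simp_all add: s_def)
          also have "((1 / s) * (1 / s) + sqrt (2 * (real C + 1)) * (1 / s)) * (s * s)
            = 1 + sqrt (2 * (real C + 1)) * s" using s(1) by (simp add: field_simps)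
          finally show ?thesis using s by (simp add: real_sqrt_mult)
        qed
        have big2: "real (card ?A) * D N < h * M N" using elim(3,5) unfolding cA by (simp add: pos_divide_less_eq)
        have N: "N \<ge> N0" "k \<le> bikes (G N)" by (fact elim)+
        have "\<bar>?ratio N - 1\<bar> \<le> err N"
          unfolding ratio err_def M_def
          by (rule pmf_indep_sum_ratio[OF G A N(2) capacity_bound[OF N(1)] D0[of N] D_route[OF N(1)] h0
                poisson_total[OF N(1), unfolded M_def] big1[unfolded M_def] big2[unfolded M_def], unfolded cA])
        then show ?thesis by simp
      qed
    qed
    then have "(\<lambda>N. ?ratio N - 1) \<longlonglongrightarrow> 0"
      by (rule Lim_null_comparison) (rule tendsto_rabs_zero[OF err])
    then show ?thesis by (simp only: LIM_zero_iff)
  qed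
  show ?thesis
    by (intro conjI allI impI, rule limit, assumption, rule order)
qed

end
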